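(* Let $R$ be an algebra over a commutative Frobenius ring $K$. Assume $R$ to be finitely generated as a $K$-module, and let $R^*=\operatorname{Hom}_K(R,K)$. The following structures related to $R$ are in bijective correspondence. (1) Associative non degenerate $K$-bilinear forms $\langle -,-\rangle:R\times R\to K$. (2) Isomorphisms of right $R$-modules $\alpha:R\to R^*$. (3) Isomorphisms of left $R$-modules $\beta:R\to R^*$. (4) $K$-linear forms $\epsilon\in R^*$ such that $\epsilon R=R^*$. (5) $K$-linear forms $\epsilon\in R^*$ such that $R\epsilon=R^*$.
   Context: All rings are unital and possibly noncommutative. A left and right artinian ring $A$ with Jacobson radical $J$ is called Frobenius if $\operatorname{Soc}({}_AA)\cong A/J$ as left $A$-modules and $\operatorname{Soc}(A_A)\cong A/J$ as right $A$-modules, where $\operatorname{Soc}$ denotes the socle. The $K$-module $R^*=\operatorname{Hom}_K(R,K)$ is an $R$-$R$-bimodule via $(fb)(b')=f(bb')=(b'f)(b)$ for $b,b'\in R$, $f\in R^*$. A $K$-bilinear form $\langle -,-\rangle : R\times R\to K$ is associative if $\langle bb',b''\rangle=\langle b,b'b''\rangle$ for all $b,b',b''\in R$. It is non degenerate if the two $K$-linear maps $R\to R^*$ given by $b\mapsto \langle b,-\rangle$ and $b\mapsto\langle -,b\rangle$ are both injective. *)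

theory Defs
  imports "HOL-Algebra.Algebra"
begin

text \<open>
  The library locale \<open>module\<close> requires a commutative ring of scalars. Modules over
  noncommutative rings are handled here through the same record type: the field \<open>smult\<close> holds the
  action of the scalars, \<open>a \<odot> x\<close> standing for \<open>a x\<close> in a left module and for \<open>x a\<close> in a right
  module. Submodules, homomorphisms, quotients and socles depend on the action only, hence they
  are defined once for both sides.
\<close>

definition left_regular :: "('a, 'm) ring_scheme \<Rightarrow> ('a, 'a) module" where
  "left_regular A =
     \<lparr>carrier = carrier A, monoid.mult = monoid.mult A,
      one = \<one>\<^bsub>A\<^esub>, ring.zero = \<zero>\<^bsub>A\<^esub>, add = add A,
      smult = (\<lambda>a x. a \<otimes>\<^bsub>A\<^esub> x)\<rparr>"

definition right_regular :: "('a, 'm) ring_scheme \<Rightarrow> ('a, 'a) module" where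
  "right_regular A =
     \<lparr>carrier = carrier A, monoid.mult = monoid.mult A,
      one = \<one>\<^bsub>A\<^esub>, ring.zero = \<zero>\<^bsub>A\<^esub>, add = add A,
      smult = (\<lambda>a x. x \<otimes>\<^bsub>A\<^esub> a)\<rparr>"

text \<open>
  Maps are required to be extensional, so that a homomorphism is determined by its values on the
  carrier of its domain, and sets of homomorphisms can be put in bijection.
\<close>

definition module_homs ::
    "('a, 'm) ring_scheme \<Rightarrow> ('a, 'b, 'n) module_scheme \<Rightarrow> ('a, 'c, 'p) module_scheme
      \<Rightarrow> ('b \<Rightarrow> 'c) set" where
  "module_homs A M N =
     {f \<in> carrier M \<rightarrow>\<^sub>E carrier N.
        (\<forall>x\<in>carrier M. \<forall>y\<in>carrier M. f (x \<oplus>\<^bsub>M\<^esub> y) = f x \<oplus>\<^bsub>N\<^esub> f y) \<and>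
        (\<forall>a\<in>carrier A. \<forall>x\<in>carrier M. f (a \<odot>\<^bsub>M\<^esub> x) = a \<odot>\<^bsub>N\<^esub> f x)}"

definition module_isos ::
    "('a, 'm) ring_scheme \<Rightarrow> ('a, 'b, 'n) module_scheme \<Rightarrow> ('a, 'c, 'p) module_scheme
      \<Rightarrow> ('b \<Rightarrow> 'c) set" where
  "module_isos A M N = {f \<in> module_homs A M N. bij_betw f (carrier M) (carrier N)}"

text \<open>The fields \<open>mult\<close> and \<open>one\<close> play no role in a module.\<close>

definition quotient_module ::
    "('a, 'b, 'n) module_scheme \<Rightarrow> 'b set \<Rightarrow> ('a, 'b set) module" where
  "quotient_module M N =
     \<lparr>carrier = a_rcosets\<^bsub>M\<^esub> N, monoid.mult = undefined,
      one = undefined, ring.zero = N, add = set_add M,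
      smult = (\<lambda>a C. N <+>\<^bsub>M\<^esub> ((\<lambda>x. a \<odot>\<^bsub>M\<^esub> x) ` C))\<rparr>"

definition simple_submodule ::
    "'b set \<Rightarrow> ('a, 'm) ring_scheme \<Rightarrow> ('a, 'b, 'n) module_scheme \<Rightarrow> bool" where
  "simple_submodule N A M \<longleftrightarrow>
     submodule N A M \<and> N \<noteq> {\<zero>\<^bsub>M\<^esub>} \<and>
     (\<forall>L. submodule L A M \<and> L \<subseteq> N \<longrightarrow> L = {\<zero>\<^bsub>M\<^esub>} \<or> L = N)"

definition maximal_submodule ::
    "'b set \<Rightarrow> ('a, 'm) ring_scheme \<Rightarrow> ('a, 'b, 'n) module_scheme \<Rightarrow> bool" where
  "maximal_submodule N A M \<longleftrightarrow>
     submodule N A M \<and> N \<noteq> carrier M \<and>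
     (\<forall>L. submodule L A M \<and> N \<subseteq> L \<longrightarrow> L = N \<or> L = carrier M)"

definition socle ::
    "('a, 'm) ring_scheme \<Rightarrow> ('a, 'b, 'n) module_scheme \<Rightarrow> 'b set" where
  "socle A M = generate (add_monoid M) (\<Union>{N. simple_submodule N A M})"

definition artinian_module ::
    "('a, 'm) ring_scheme \<Rightarrow> ('a, 'b, 'n) module_scheme \<Rightarrow> bool" where
  "artinian_module A M \<longleftrightarrow>
     (\<forall>I :: nat \<Rightarrow> 'b set. (\<forall>n. submodule (I n) A M) \<and> (\<forall>n. I (Suc n) \<subseteq> I n) \<longrightarrow>
        (\<exists>m. \<forall>n\<ge>m. I n = I m))"

text \<open>
  Intersecting within the carrier makes the radical of the zero ring, which has no maximal left
  ideal, equal to the ring itself.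
\<close>

definition jacobson_radical :: "('a, 'm) ring_scheme \<Rightarrow> 'a set" where
  "jacobson_radical A =
     carrier A \<inter> \<Inter>{I. maximal_submodule I A (left_regular A)}"

definition frobenius_ring :: "('a, 'm) ring_scheme \<Rightarrow> bool" where
  "frobenius_ring A \<longleftrightarrow>
     ring A \<and>
     artinian_module A (left_regular A) \<and>
     artinian_module A (right_regular A) \<and>
     module_isos A
       ((left_regular A)\<lparr>carrier := socle A (left_regular A)\<rparr>)
       (quotient_module (left_regular A) (jacobson_radical A)) \<noteq> {} \<and>
     module_isos A
       ((right_regular A)\<lparr>carrier := socle A (right_regular A)\<rparr>)
       (quotient_module (right_regular A) (jacobson_radical A)) \<noteq> {}"

text \<open>The library locale \<open>algebra\<close> covers commutative algebras only.\<close>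

locale ring_algebra = module K R + A: ring R
  for K (structure) and R (structure) +
  assumes smult_mult_left:
      "\<lbrakk>a \<in> carrier K; x \<in> carrier R; y \<in> carrier R\<rbrakk> \<Longrightarrow>
       (a \<odot>\<^bsub>R\<^esub> x) \<otimes>\<^bsub>R\<^esub> y = a \<odot>\<^bsub>R\<^esub> (x \<otimes>\<^bsub>R\<^esub> y)"
    and smult_mult_right:
      "\<lbrakk>a \<in> carrier K; x \<in> carrier R; y \<in> carrier R\<rbrakk> \<Longrightarrow>
       x \<otimes>\<^bsub>R\<^esub> (a \<odot>\<^bsub>R\<^esub> y) = a \<odot>\<^bsub>R\<^esub> (x \<otimes>\<^bsub>R\<^esub> y)"

definition finitely_generated_module ::
    "('a, 'm) ring_scheme \<Rightarrow> ('a, 'b, 'n) module_scheme \<Rightarrow> bool" where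
  "finitely_generated_module A M \<longleftrightarrow>
     (\<exists>S. finite S \<and> S \<subseteq> carrier M \<and>
        (\<forall>x\<in>carrier M. \<exists>c\<in>S \<rightarrow> carrier A. x = (\<Oplus>\<^bsub>M\<^esub>s\<in>S. c s \<odot>\<^bsub>M\<^esub> s)))"

definition dual :: "('k, 'm) ring_scheme \<Rightarrow> ('k, 'r, 'n) module_scheme \<Rightarrow> ('r \<Rightarrow> 'k) set" where
  "dual K R = module_homs K R (left_regular K)"

text \<open>
  The two sides of the bimodule \<open>R\<^sup>*\<close>: the scalar \<open>b\<close> sends \<open>f\<close> to \<open>f b\<close>, that is
  \<open>x \<mapsto> f (b x)\<close>, in the right module, and to \<open>b f\<close>, that is \<open>x \<mapsto> f (x b)\<close>, in the left module.
\<close>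

definition dual_right ::
    "('k, 'm) ring_scheme \<Rightarrow> ('k, 'r, 'n) module_scheme \<Rightarrow> ('r, 'r \<Rightarrow> 'k) module" where
  "dual_right K R =
     \<lparr>carrier = dual K R, monoid.mult = undefined, one = undefined,
      ring.zero = (\<lambda>x\<in>carrier R. \<zero>\<^bsub>K\<^esub>),
      add = (\<lambda>f g. \<lambda>x\<in>carrier R. f x \<oplus>\<^bsub>K\<^esub> g x),
      smult = (\<lambda>b f. \<lambda>x\<in>carrier R. f (b \<otimes>\<^bsub>R\<^esub> x))\<rparr>"

definition dual_left ::
    "('k, 'm) ring_scheme \<Rightarrow> ('k, 'r, 'n) module_scheme \<Rightarrow> ('r, 'r \<Rightarrow> 'k) module" where
  "dual_left K R =
     \<lparr>carrier = dual K R, monoid.mult = undefined, one = undefined,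
      ring.zero = (\<lambda>x\<in>carrier R. \<zero>\<^bsub>K\<^esub>),
      add = (\<lambda>f g. \<lambda>x\<in>carrier R. f x \<oplus>\<^bsub>K\<^esub> g x),
      smult = (\<lambda>b f. \<lambda>x\<in>carrier R. f (x \<otimes>\<^bsub>R\<^esub> b))\<rparr>"

text \<open>
  Bilinear forms are curried and extensional in both arguments. The maps \<open>slot_right\<close> and
  \<open>slot_left\<close> are \<open>b \<mapsto> \<langle>b, -\<rangle>\<close> and \<open>b \<mapsto> \<langle>-, b\<rangle>\<close>.
\<close>

definition slot_right ::
    "('k, 'r, 'n) module_scheme \<Rightarrow> ('r \<Rightarrow> 'r \<Rightarrow> 'k) \<Rightarrow> 'r \<Rightarrow> 'r \<Rightarrow> 'k" where
  "slot_right R B = (\<lambda>b\<in>carrier R. \<lambda>x\<in>carrier R. B b x)"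

definition slot_left ::
    "('k, 'r, 'n) module_scheme \<Rightarrow> ('r \<Rightarrow> 'r \<Rightarrow> 'k) \<Rightarrow> 'r \<Rightarrow> 'r \<Rightarrow> 'k" where
  "slot_left R B = (\<lambda>b\<in>carrier R. \<lambda>x\<in>carrier R. B x b)"

definition bilinear_forms ::
    "('k, 'm) ring_scheme \<Rightarrow> ('k, 'r, 'n) module_scheme \<Rightarrow> ('r \<Rightarrow> 'r \<Rightarrow> 'k) set" where
  "bilinear_forms K R =
     {B \<in> carrier R \<rightarrow>\<^sub>E carrier R \<rightarrow>\<^sub>E carrier K.
        \<forall>b\<in>carrier R. slot_right R B b \<in> dual K R \<and> slot_left R B b \<in> dual K R}"

definition associative_form ::
    "('k, 'r, 'n) module_scheme \<Rightarrow> ('r \<Rightarrow> 'r \<Rightarrow> 'k) \<Rightarrow> bool" where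
  "associative_form R B \<longleftrightarrow>
     (\<forall>x\<in>carrier R. \<forall>y\<in>carrier R. \<forall>z\<in>carrier R. B (x \<otimes>\<^bsub>R\<^esub> y) z = B x (y \<otimes>\<^bsub>R\<^esub> z))"

definition nondegenerate_form ::
    "('k, 'r, 'n) module_scheme \<Rightarrow> ('r \<Rightarrow> 'r \<Rightarrow> 'k) \<Rightarrow> bool" where
  "nondegenerate_form R B \<longleftrightarrow>
     inj_on (slot_right R B) (carrier R) \<and> inj_on (slot_left R B) (carrier R)"

definition frobenius_forms ::
    "('k, 'm) ring_scheme \<Rightarrow> ('k, 'r, 'n) module_scheme \<Rightarrow> ('r \<Rightarrow> 'r \<Rightarrow> 'k) set" where
  "frobenius_forms K R =
     {B \<in> bilinear_forms K R. associative_form R B \<and> nondegenerate_form R B}"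

definition right_isos ::
    "('k, 'm) ring_scheme \<Rightarrow> ('k, 'r, 'n) module_scheme \<Rightarrow> ('r \<Rightarrow> 'r \<Rightarrow> 'k) set" where
  "right_isos K R = module_isos R (right_regular R) (dual_right K R)"

definition left_isos ::
    "('k, 'm) ring_scheme \<Rightarrow> ('k, 'r, 'n) module_scheme \<Rightarrow> ('r \<Rightarrow> 'r \<Rightarrow> 'k) set" where
  "left_isos K R = module_isos R (left_regular R) (dual_left K R)"

definition right_generators ::
    "('k, 'm) ring_scheme \<Rightarrow> ('k, 'r, 'n) module_scheme \<Rightarrow> ('r \<Rightarrow> 'k) set" where
  "right_generators K R =
     {\<epsilon> \<in> dual K R. {b \<odot>\<^bsub>dual_right K R\<^esub> \<epsilon> | b. b \<in> carrier R} = dual K R}"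

definition left_generators ::
    "('k, 'm) ring_scheme \<Rightarrow> ('k, 'r, 'n) module_scheme \<Rightarrow> ('r \<Rightarrow> 'k) set" where
  "left_generators K R =
     {\<epsilon> \<in> dual K R. {b \<odot>\<^bsub>dual_left K R\<^esub> \<epsilon> | b. b \<in> carrier R} = dual K R}"

end

theory Submission
  imports Defs "HOL-Library.Extended_Nat"
begin

text \<open>
  Over a commutative Frobenius ring the functor \<open>M \<mapsto> Hom(M, K)\<close> preserves the length of finitely
  generated modules: every simple module \<open>K/m\<close> has dual \<open>ann m\<close>, which is simple because
  \<open>Soc K \<cong> K/J\<close>, so dualising cannot increase lengths; comparing the lengths of an ideal and of its
  annihilator shows that \<open>K\<close> is self-injective, which gives the converse inequality. Hence
  \<open>R\<close> and \<open>R\<^sup>*\<close> have the same finite length, functionals separate the points of \<open>R\<close>, and a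
  \<open>K\<close>-linear map \<open>R \<rightarrow> R\<^sup>*\<close> is injective iff it is surjective. An associative form is
  \<open>(x, y) \<mapsto> \<epsilon> (x y)\<close> for the functional \<open>\<epsilon> = \<langle>1, -\<rangle>\<close>, and its two slot maps are \<open>b \<mapsto> \<epsilon> b\<close> and
  \<open>b \<mapsto> b \<epsilon>\<close>; by the above, if one of the two is injective or surjective, then both are bijective.
\<close>

section \<open>Lengths of chains\<close>

text \<open>The hypotheses provide descending chain conditions, not composition series. Lengths are
  therefore suprema in \<open>enat\<close>, available before any finiteness is known; their
  additivity takes the place of the Jordan-Hoelder theorem, and the finite length of
  \<open>K\<close> itself has to be derived. The socle isomorphism is an unknown map, and all that
  is extracted from it is that, for a maximal ideal m, every nonzero element of ann m generates ann
  m. Self-injectivity is then a matter of counting: l(ann I) \<le> l(K/I) and l(K/ann I) \<le> l(I)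
  have the same finite sum l(K) on both sides, so both are equalities. This leaves no room for a
  functional on I other than the multiplications, and such a multiplier is exactly the value needed
  to extend a functional over one more generator.\<close>

inductive chain_to :: "'a set set \<Rightarrow> nat \<Rightarrow> 'a set \<Rightarrow> bool" for F where
  chain_to_base: "A \<in> F \<Longrightarrow> chain_to F 0 A"
| chain_to_step: "chain_to F n A \<Longrightarrow> B \<in> F \<Longrightarrow> A \<subset> B \<Longrightarrow> chain_to F (Suc n) B"

text \<open>Strict inclusions are counted, not members, so that the submodules of a simple module
  give length 1.\<close>

definition chain_length :: "'a set set \<Rightarrow> enat" where
  "chain_length F = (SUP n\<in>{n. \<exists>A. chain_to F n A}. enat n)"

lemma chain_length_upper: "chain_to F n A \<Longrightarrow> enat n \<le> chain_length F"
  unfolding chain_length_def by (rule SUP_upper) auto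

lemma chain_length_least:
  "(\<And>n A. chain_to F n A \<Longrightarrow> enat n \<le> x) \<Longrightarrow> chain_length F \<le> x"
  unfolding chain_length_def by (rule SUP_least) auto

lemma chain_to_mem: "chain_to F n A \<Longrightarrow> A \<in> F"
  by (induction rule: chain_to.induct) auto

lemma chain_to_image:
  assumes "chain_to F n A"
    and "\<And>A. A \<in> F \<Longrightarrow> f A \<in> G"
    and "\<And>A B. A \<in> F \<Longrightarrow> B \<in> F \<Longrightarrow> A \<subset> B \<Longrightarrow> f A \<subset> f B"
  shows "chain_to G n (f A)"
  using assms(1)
proof (induction rule: chain_to.induct)
  case (chain_to_base A)
  then show ?case by (simp add: assms(2) chain_to.chain_to_base)
next
  case (chain_to_step n A B)
  then show ?case by (metis assms(2,3) chain_to.chain_to_step chain_to_mem)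
qed

lemma chain_length_image_le:
  assumes "\<And>A. A \<in> F \<Longrightarrow> f A \<in> G"
    and "\<And>A B. A \<in> F \<Longrightarrow> B \<in> F \<Longrightarrow> A \<subset> B \<Longrightarrow> f A \<subset> f B"
  shows "chain_length F \<le> chain_length G"
  by (rule chain_length_least) (rule chain_length_upper[OF chain_to_image[OF _ assms]])

text \<open>Project a chain by \<open>f\<close> and by \<open>g\<close> and delete repetitions: each
  strict inclusion survives in at least one of the projections, so the two lengths together account
  for every step.\<close>

lemma chain_length_le_add:
  assumes fG: "\<And>A. A \<in> F \<Longrightarrow> f A \<in> G" and gH: "\<And>A. A \<in> F \<Longrightarrow> g A \<in> H"
    and strict: "\<And>A B. A \<in> F \<Longrightarrow> B \<in> F \<Longrightarrow> A \<subset> B \<Longrightarrow>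
      f A \<subseteq> f B \<and> g A \<subseteq> g B \<and> (f A \<noteq> f B \<or> g A \<noteq> g B)"
  shows "chain_length F \<le> chain_length G + chain_length H"
proof (rule chain_length_least)
  fix n A
  assume "chain_to F n A"
  then have "\<exists>p q. chain_to G p (f A) \<and> chain_to H q (g A) \<and> n \<le> p + q"
  proof (induction rule: chain_to.induct)
    case (chain_to_base A)
    then show ?case using fG gH by (metis chain_to.chain_to_base le0)
  next
    case (chain_to_step n A B)
    then obtain p q where pq: "chain_to G p (f A)" "chain_to H q (g A)" "n \<le> p + q" by blast
    have AB: "f A \<subseteq> f B" "g A \<subseteq> g B" "f A \<noteq> f B \<or> g A \<noteq> g B"
      using strict[OF chain_to_mem[OF chain_to_step(1)] chain_to_step(2,3)] by auto
    have f: "chain_to G (if f A = f B then p else Suc p) (f B)"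
      using pq(1) AB(1) fG[OF chain_to_step(2)] by (auto intro: chain_to.chain_to_step)
    have g: "chain_to H (if g A = g B then q else Suc q) (g B)"
      using pq(2) AB(2) gH[OF chain_to_step(2)] by (auto intro: chain_to.chain_to_step)
    show ?case
      using f g AB(3) pq(3)
      by (intro exI[of _ "if f A = f B then p else Suc p"] exI[of _ "if g A = g B then q else Suc q"]) auto
  qed
  then obtain p q where "chain_to G p (f A)" "chain_to H q (g A)" "n \<le> p + q" by blast
  moreover from this have "enat p + enat q \<le> chain_length G + chain_length H"
    by (intro add_mono chain_length_upper)
  moreover have "enat n \<le> enat p + enat q" if "n \<le> p + q" using that by simp
  ultimately show "enat n \<le> chain_length G + chain_length H"
    by (meson order_trans)
qed

text \<open>Concatenation of chains. The top of the lower chain and the bottom of the upper one may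
  coincide or differ, so the result has length at least, not exactly, n + m.\<close>

lemma chain_length_append_le:
  assumes sub: "F \<subseteq> H" "G \<subseteq> H" and below: "\<And>A B. A \<in> F \<Longrightarrow> B \<in> G \<Longrightarrow> A \<subseteq> B"
    and ne: "F \<noteq> {}" "G \<noteq> {}"
  shows "chain_length F + chain_length G \<le> chain_length H"
proof -
  have app: "\<exists>k\<ge>n + m. chain_to H k B" if A: "chain_to F n A" and B: "chain_to G m B" for n A m B
    using B
  proof (induction rule: chain_to.induct)
    case (chain_to_base B)
    have "chain_to H n A"
      using chain_to_image[OF A, of "\<lambda>x. x" H] sub by auto
    moreover have "B \<in> H" "A \<subseteq> B"
      using below[OF chain_to_mem[OF A] chain_to_base] sub(2) chain_to_base by auto
    ultimately have "chain_to H n B \<or> chain_to H (Suc n) B"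
      by (metis chain_to.chain_to_step psubsetI)
    then show ?case by (metis add_0_right le_SucI order_refl)
  next
    case (chain_to_step m B C)
    then obtain k where "k \<ge> n + m" "chain_to H k B" by blast
    then show ?case
      using chain_to_step sub(2) by (auto intro!: exI[of _ "Suc k"] chain_to.chain_to_step)
  qed
  have le: "enat n + enat m \<le> chain_length H" if "chain_to F n A" "chain_to G m B" for n A m B
  proof -
    obtain k where "n + m \<le> k" "chain_to H k B" using app[OF \<open>chain_to F n A\<close> \<open>chain_to G m B\<close>] by blast
    then have "enat n + enat m \<le> enat k" "enat k \<le> chain_length H"
      using chain_length_upper by auto
    then show ?thesis by (rule order_trans)
  qed
  obtain A B where AB: "A \<in> F" "B \<in> G" using ne by blast
  show ?thesis
  proof (cases "chain_length H")
    case infinity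
    then show ?thesis by simp
  next
    case (enat h)
    have "chain_length F \<le> enat h"
      by (rule chain_length_least) (use le[OF _ chain_to_base[OF AB(2)]] enat in auto)
    then obtain f where f: "chain_length F = enat f" by (metis enat_ile)
    have "chain_length G \<le> enat h"
      by (rule chain_length_least) (use le[OF chain_to_base[OF AB(1)]] enat in auto)
    then obtain g where g: "chain_length G = enat g" by (metis enat_ile)
    \<comment> \<open>The suprema are taken one variable at a time by moving the other number to the
      right-hand side. Truncated subtraction would lose information for n > h, so n \<le> h is
      carried along.\<close>
    have 1: "enat m \<le> enat (h - n) \<and> n \<le> h" if "chain_to F n A" "chain_to G m B" for n A m B
      using le[OF that] enat by auto
    have "chain_length G \<le> enat (h - n) \<and> n \<le> h" if "chain_to F n A" for n A
      using 1[OF that] chain_to_base[OF AB(2)] by (metis chain_length_least)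
    then have "enat n \<le> enat (h - g) \<and> g \<le> h" if "chain_to F n A" for n A
      using that g by fastforce
    then have "chain_length F \<le> enat (h - g) \<and> g \<le> h"
      using chain_to_base[OF AB(1)] by (metis chain_length_least)
    then show ?thesis using f g enat by auto
  qed
qed

section \<open>Length of a module\<close>

text \<open>
  Quotients are avoided: \<open>module_length A M N L\<close> is the length of \<open>L/N\<close>, read off the submodules
  between \<open>N\<close> and \<open>L\<close>.
\<close>

definition module_length ::
    "('a, 'm) ring_scheme \<Rightarrow> ('a, 'b, 'n) module_scheme \<Rightarrow> 'b set \<Rightarrow> 'b set \<Rightarrow> enat" where
  "module_length A M N L = chain_length {S. submodule S A M \<and> N \<subseteq> S \<and> S \<subseteq> L}"

lemma module_length_self [simp]: "module_length A M N N = 0"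
proof -
  have "chain_to {S. submodule S A M \<and> N \<subseteq> S \<and> S \<subseteq> N} n S \<Longrightarrow> n = 0" for n S
    by (induction rule: chain_to.induct) (auto dest!: chain_to_mem)
  then have "module_length A M N N \<le> 0"
    unfolding module_length_def by (intro chain_length_least) (simp add: zero_enat_def)
  then show ?thesis by (simp only: ile0_eq)
qed

lemma module_length_pos:
  assumes "submodule N A M" "submodule L A M" "N \<subset> L"
  shows "1 \<le> module_length A M N L"
proof -
  have "chain_to {S. submodule S A M \<and> N \<subseteq> S \<and> S \<subseteq> L} (Suc 0) L"
    by (rule chain_to_step[OF chain_to_base[of N]]) (use assms in auto)
  from chain_length_upper[OF this] show ?thesis
    by (simp add: module_length_def one_enat_def)
qed

lemma module_length_image_le:
  assumes "\<And>S. submodule S A M \<Longrightarrow> N \<subseteq> S \<Longrightarrow> S \<subseteq> L \<Longrightarrow>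
      submodule (f S) A' M' \<and> N' \<subseteq> f S \<and> f S \<subseteq> L'"
    and "\<And>S T. submodule S A M \<Longrightarrow> submodule T A M \<Longrightarrow> N \<subseteq> S \<Longrightarrow> T \<subseteq> L \<Longrightarrow> S \<subset> T \<Longrightarrow> f S \<subset> f T"
  shows "module_length A M N L \<le> module_length A' M' N' L'"
  unfolding module_length_def
proof (rule chain_length_image_le[of _ f])
  show "f S \<in> {S. submodule S A' M' \<and> N' \<subseteq> S \<and> S \<subseteq> L'}"
    if "S \<in> {S. submodule S A M \<and> N \<subseteq> S \<and> S \<subseteq> L}" for S
    using assms(1)[of S] that by simp
  show "f S \<subset> f T" if "S \<in> {S. submodule S A M \<and> N \<subseteq> S \<and> S \<subseteq> L}"
    "T \<in> {S. submodule S A M \<and> N \<subseteq> S \<and> S \<subseteq> L}" "S \<subset> T" for S T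
    by (rule assms(2)) (use that in simp_all)
qed

lemma module_length_mono:
  "N' \<subseteq> N \<Longrightarrow> L \<subseteq> L' \<Longrightarrow> module_length A M N L \<le> module_length A M N' L'"
  by (rule module_length_image_le[where f = "\<lambda>S. S"]) (blast, assumption)

section \<open>Cyclic submodules, sums, and additivity of length\<close>

definition cyclic_submodule ::
    "('a, 'm) ring_scheme \<Rightarrow> ('a, 'b, 'n) module_scheme \<Rightarrow> 'b \<Rightarrow> 'b set" where
  "cyclic_submodule A M x = (\<lambda>a. a \<odot>\<^bsub>M\<^esub> x) ` carrier A"

context module
begin

lemma submodule_zero: "submodule H R M \<Longrightarrow> \<zero>\<^bsub>M\<^esub> \<in> H"
  by (metis submodule.axioms(1) subgroup.one_closed monoid.select_convs(2))

lemma submodule_carrier: "submodule H R M \<Longrightarrow> x \<in> H \<Longrightarrow> x \<in> carrier M"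
  using submoduleE(1) by blast

lemma submodule_cancel_left:
  assumes "submodule H R M" "x \<in> H" "y \<in> carrier M" "x \<oplus>\<^bsub>M\<^esub> y \<in> H"
  shows "y \<in> H"
proof -
  have x: "x \<in> carrier M" using assms submodule_carrier by blast
  have "y = \<ominus>\<^bsub>M\<^esub> x \<oplus>\<^bsub>M\<^esub> (x \<oplus>\<^bsub>M\<^esub> y)"
    using x assms(3) by (simp add: M.r_neg1)
  then show ?thesis using submoduleE(3)[OF assms(1,2)] submoduleE(5)[OF assms(1) _ assms(4)] by metis
qed

lemma submodule_smult: "submodule H R M \<Longrightarrow> a \<in> carrier R \<Longrightarrow> x \<in> H \<Longrightarrow> a \<odot>\<^bsub>M\<^esub> x \<in> H"
  by (rule submoduleE(4))

lemma submodule_inter: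
  "submodule H R M \<Longrightarrow> submodule N R M \<Longrightarrow> submodule (H \<inter> N) R M"
  by (rule submoduleI) (auto simp: submodule_zero submoduleE submodule_carrier)

lemma submodule_singleton_zero: "submodule {\<zero>\<^bsub>M\<^esub>} R M"
  by (rule submoduleI) auto

lemma mem_set_add: "x \<in> H <+>\<^bsub>M\<^esub> N \<longleftrightarrow> (\<exists>h\<in>H. \<exists>n\<in>N. x = h \<oplus>\<^bsub>M\<^esub> n)"
  by (auto simp: set_add_def')

lemma submodule_set_add:
  assumes H: "submodule H R M" and N: "submodule N R M"
  shows "submodule (H <+>\<^bsub>M\<^esub> N) R M"
proof (rule submoduleI)
  note car = submodule_carrier[OF H] submodule_carrier[OF N]
  show "H <+>\<^bsub>M\<^esub> N \<subseteq> carrier M" using car by (auto simp: mem_set_add)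
  show "\<zero>\<^bsub>M\<^esub> \<in> H <+>\<^bsub>M\<^esub> N"
    using submodule_zero[OF H] submodule_zero[OF N] by (force simp: mem_set_add)
  show "\<ominus>\<^bsub>M\<^esub> a \<in> H <+>\<^bsub>M\<^esub> N" if "a \<in> H <+>\<^bsub>M\<^esub> N" for a
  proof -
    obtain h n where "h \<in> H" "n \<in> N" "a = h \<oplus>\<^bsub>M\<^esub> n"
      using \<open>a \<in> H <+>\<^bsub>M\<^esub> N\<close> by (auto simp: mem_set_add)
    moreover from this have "\<ominus>\<^bsub>M\<^esub> a = \<ominus>\<^bsub>M\<^esub> h \<oplus>\<^bsub>M\<^esub> \<ominus>\<^bsub>M\<^esub> n"
      using car by (simp add: M.minus_add)
    ultimately show ?thesis
      unfolding mem_set_add using submoduleE(3)[OF H] submoduleE(3)[OF N] by blast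
  qed
  show "a \<oplus>\<^bsub>M\<^esub> b \<in> H <+>\<^bsub>M\<^esub> N" if ab: "a \<in> H <+>\<^bsub>M\<^esub> N" "b \<in> H <+>\<^bsub>M\<^esub> N" for a b
  proof -
    obtain h n h' n' where *: "h \<in> H" "n \<in> N" "a = h \<oplus>\<^bsub>M\<^esub> n" "h' \<in> H" "n' \<in> N" "b = h' \<oplus>\<^bsub>M\<^esub> n'"
      using ab by (auto simp: mem_set_add)
    then have "a \<oplus>\<^bsub>M\<^esub> b = (h \<oplus>\<^bsub>M\<^esub> h') \<oplus>\<^bsub>M\<^esub> (n \<oplus>\<^bsub>M\<^esub> n')"
      using car by (simp add: M.add.m_ac)
    then show ?thesis
      unfolding mem_set_add using * submoduleE(5)[OF H] submoduleE(5)[OF N] by blast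
  qed
  show "a \<odot>\<^bsub>M\<^esub> x \<in> H <+>\<^bsub>M\<^esub> N" if a: "a \<in> carrier R" and x: "x \<in> H <+>\<^bsub>M\<^esub> N" for a x
  proof -
    obtain h n where "h \<in> H" "n \<in> N" "x = h \<oplus>\<^bsub>M\<^esub> n" using x by (auto simp: mem_set_add)
    moreover from this have "a \<odot>\<^bsub>M\<^esub> x = a \<odot>\<^bsub>M\<^esub> h \<oplus>\<^bsub>M\<^esub> a \<odot>\<^bsub>M\<^esub> n"
      using car a by (simp add: smult_r_distr)
    ultimately show ?thesis
      unfolding mem_set_add using submodule_smult[OF H a] submodule_smult[OF N a] by blast
  qed
qed

lemma set_add_upper:
  assumes "submodule H R M" "submodule N R M"
  shows "H \<subseteq> H <+>\<^bsub>M\<^esub> N" "N \<subseteq> H <+>\<^bsub>M\<^esub> N"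
  using assms submodule_zero submodule_carrier M.r_zero M.l_zero unfolding mem_set_add subset_iff
  by metis+

lemma set_add_least:
  assumes "submodule L R M" "H \<subseteq> L" "N \<subseteq> L"
  shows "H <+>\<^bsub>M\<^esub> N \<subseteq> L"
proof
  fix x assume "x \<in> H <+>\<^bsub>M\<^esub> N"
  then obtain h n where "h \<in> L" "n \<in> L" "x = h \<oplus>\<^bsub>M\<^esub> n" using assms by (auto simp: mem_set_add)
  then show "x \<in> L" using submoduleE(5)[OF assms(1)] by simp
qed

text \<open>Dedekind's modular law: if S is contained in T, equal intersections with N and equal
  sums with N force S = T. Hence a strict step stays strict inside N or above N.\<close>

lemma module_length_add_le:
  assumes N: "submodule N R M" and NB: "A \<subseteq> N" "N \<subseteq> B" and B: "submodule B R M"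
  shows "module_length R M A B \<le> module_length R M A N + module_length R M N B"
  unfolding module_length_def
proof (rule chain_length_le_add[of _ "\<lambda>S. S \<inter> N" _ "\<lambda>S. S <+>\<^bsub>M\<^esub> N"])
  fix S assume "S \<in> {S. submodule S R M \<and> A \<subseteq> S \<and> S \<subseteq> B}"
  then have S: "submodule S R M" "A \<subseteq> S" "S \<subseteq> B" by auto
  show "S \<inter> N \<in> {S. submodule S R M \<and> A \<subseteq> S \<and> S \<subseteq> N}"
    using S NB submodule_inter[OF S(1) N] by auto
  show "S <+>\<^bsub>M\<^esub> N \<in> {S. submodule S R M \<and> N \<subseteq> S \<and> S \<subseteq> B}"
    using submodule_set_add[OF S(1) N] set_add_upper[OF S(1) N] set_add_least[OF B S(3) NB(2)] by auto
next
  fix S T assume "S \<in> {S. submodule S R M \<and> A \<subseteq> S \<and> S \<subseteq> B}"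
    "T \<in> {S. submodule S R M \<and> A \<subseteq> S \<and> S \<subseteq> B}" and ST: "S \<subset> T"
  then have S: "submodule S R M" and T: "submodule T R M" by auto
  have "False" if eq: "S \<inter> N = T \<inter> N" "S <+>\<^bsub>M\<^esub> N = T <+>\<^bsub>M\<^esub> N"
  proof -
    obtain t where t: "t \<in> T" "t \<notin> S" using ST by blast
    then have "t \<in> S <+>\<^bsub>M\<^esub> N" using eq set_add_upper(1)[OF T N] by blast
    then obtain s n where sn: "s \<in> S" "n \<in> N" "t = s \<oplus>\<^bsub>M\<^esub> n" by (auto simp: mem_set_add)
    then have "n \<in> T"
      using submodule_cancel_left[OF T, of s n] t ST submodule_carrier[OF N] by blast
    then have "n \<in> S" using sn eq by blast
    then show False using sn t submoduleE(5)[OF S] by blast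
  qed
  moreover have "S <+>\<^bsub>M\<^esub> N \<subseteq> T <+>\<^bsub>M\<^esub> N" using ST unfolding subset_iff mem_set_add by blast
  ultimately show "S \<inter> N \<subseteq> T \<inter> N \<and> S <+>\<^bsub>M\<^esub> N \<subseteq> T <+>\<^bsub>M\<^esub> N
      \<and> (S \<inter> N \<noteq> T \<inter> N \<or> S <+>\<^bsub>M\<^esub> N \<noteq> T <+>\<^bsub>M\<^esub> N)"
    using ST by blast
qed

text \<open>The reverse inequality concatenates a chain below N with a chain above N, so additivity
  also covers infinite lengths.\<close>

lemma module_length_add:
  assumes "submodule A R M" "submodule N R M" "submodule B R M" "A \<subseteq> N" "N \<subseteq> B"
  shows "module_length R M A B = module_length R M A N + module_length R M N B"
proof (rule antisym)
  show "module_length R M A B \<le> module_length R M A N + module_length R M N B"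
    using assms by (intro module_length_add_le)
  show "module_length R M A N + module_length R M N B \<le> module_length R M A B"
    unfolding module_length_def by (rule chain_length_append_le) (use assms in auto)
qed

text \<open>Finiteness below N is what makes the additional step count, since \<infinity> + 1 =
  \<infinity>.\<close>

lemma module_length_strict_mono:
  assumes "submodule A R M" "submodule N R M" "submodule B R M" "A \<subseteq> N" "N \<subset> B"
    and "module_length R M A N \<noteq> \<infinity>"
  shows "module_length R M A N < module_length R M A B"
proof -
  have "1 \<le> module_length R M N B" using assms by (intro module_length_pos)
  then show ?thesis
    using module_length_add[of A N B] assms
    by (cases "module_length R M A N"; cases "module_length R M N B") (auto simp: one_enat_def)
qed

lemma mem_cyclic_submodule: "x \<in> cyclic_submodule R M y \<longleftrightarrow> (\<exists>a\<in>carrier R. x = a \<odot>\<^bsub>M\<^esub> y)"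
  by (auto simp: cyclic_submodule_def)

lemma generator_mem_cyclic: "x \<in> carrier M \<Longrightarrow> x \<in> cyclic_submodule R M x"
  unfolding mem_cyclic_submodule by (metis smult_one R.one_closed)

lemma submodule_cyclic:
  assumes x: "x \<in> carrier M"
  shows "submodule (cyclic_submodule R M x) R M"
proof (rule submoduleI)
  show "cyclic_submodule R M x \<subseteq> carrier M" using x by (auto simp: mem_cyclic_submodule)
  show "\<zero>\<^bsub>M\<^esub> \<in> cyclic_submodule R M x"
    using x unfolding mem_cyclic_submodule by (metis smult_l_null R.zero_closed)
  show "\<ominus>\<^bsub>M\<^esub> a \<in> cyclic_submodule R M x" if "a \<in> cyclic_submodule R M x" for a
    using that x unfolding mem_cyclic_submodule by (metis smult_l_minus R.a_inv_closed)
  show "a \<oplus>\<^bsub>M\<^esub> b \<in> cyclic_submodule R M x"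
    if "a \<in> cyclic_submodule R M x" "b \<in> cyclic_submodule R M x" for a b
    using that x unfolding mem_cyclic_submodule by (metis smult_l_distr R.a_closed)
  show "a \<odot>\<^bsub>M\<^esub> y \<in> cyclic_submodule R M x" if "a \<in> carrier R" "y \<in> cyclic_submodule R M x" for a y
    using that x unfolding mem_cyclic_submodule by (metis smult_assoc1 R.m_closed)
qed

lemma cyclic_submodule_least: "submodule H R M \<Longrightarrow> x \<in> H \<Longrightarrow> cyclic_submodule R M x \<subseteq> H"
  using submodule_smult by (auto simp: cyclic_submodule_def)

end

section \<open>Commutative Frobenius rings\<close>

lemma left_regular_simps [simp]:
  "carrier (left_regular A) = carrier A"
  "\<zero>\<^bsub>left_regular A\<^esub> = \<zero>\<^bsub>A\<^esub>"
  "x \<oplus>\<^bsub>left_regular A\<^esub> y = x \<oplus>\<^bsub>A\<^esub> y"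
  "a \<odot>\<^bsub>left_regular A\<^esub> x = a \<otimes>\<^bsub>A\<^esub> x"
  by (simp_all add: left_regular_def)

lemma a_inv_left_regular [simp]: "\<ominus>\<^bsub>left_regular A\<^esub> x = \<ominus>\<^bsub>A\<^esub> x"
  by (simp add: a_inv_def m_inv_def)

lemma (in cring) left_regular_module: "module R (left_regular R)"
proof (rule moduleI)
  show "abelian_group (left_regular R)"
    by (rule abelian_groupI) (auto simp: a_assoc intro: a_comm l_neg bexI[of _ "\<ominus> _"])
qed (auto simp: l_distr r_distr m_assoc is_cring)

text \<open>The ideal (N : s) is the kernel of a -> a s modulo N; the ring modulo this ideal stands
  for the cyclic quotient (N + Rs)/N.\<close>

lemma (in module) transporter_submodule:
  assumes N: "submodule N R M" and s: "s \<in> carrier M"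
  shows "submodule {a \<in> carrier R. a \<odot>\<^bsub>M\<^esub> s \<in> N} R (left_regular R)"
  by (rule module.submoduleI[OF R.left_regular_module])
    (auto simp: s submodule_zero[OF N] smult_l_minus smult_l_distr smult_assoc1 submoduleE[OF N])

locale commutative_frobenius = cring K for K :: "('a, 'm) ring_scheme" (structure) +
  assumes frobenius: "frobenius_ring K"
begin

sublocale regular: module K "left_regular K"
  by (rule left_regular_module)

section \<open>Maximal ideals, their annihilators, and the socle\<close>

definition annihilator :: "'a set \<Rightarrow> 'a set" where
  "annihilator I = {x \<in> carrier K. \<forall>a\<in>I. a \<otimes> x = \<zero>}"

text \<open>The quotient K/m is a field: r is an inverse of u modulo m, found because m + Ku exceeds
  m and hence contains 1.\<close>

lemma maximal_submodule_unit:
  assumes m: "maximal_submodule m K (left_regular K)" and u: "u \<in> carrier K" "u \<notin> m"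
  shows "\<exists>r\<in>carrier K. \<one> \<ominus> r \<otimes> u \<in> m"
proof -
  let ?C = "cyclic_submodule K (left_regular K) u"
  have sub: "submodule m K (left_regular K)" "submodule ?C K (left_regular K)"
    using m regular.submodule_cyclic[of u] u by (auto simp: maximal_submodule_def)
  note up = regular.set_add_upper[OF sub]
  have "u \<in> m <+>\<^bsub>left_regular K\<^esub> ?C" using up(2) regular.generator_mem_cyclic[of u] u by auto
  then have "m <+>\<^bsub>left_regular K\<^esub> ?C = carrier K"
    using m u up(1) regular.submodule_set_add[OF sub] unfolding maximal_submodule_def by auto
  then have "\<one> \<in> m <+>\<^bsub>left_regular K\<^esub> ?C" by simp
  then obtain t r where tr: "t \<in> m" "r \<in> carrier K" "\<one> = t \<oplus> r \<otimes> u"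
    by (auto simp: regular.mem_set_add regular.mem_cyclic_submodule)
  have "t \<in> carrier K" using tr regular.submodule_carrier[OF sub(1)] by simp
  then have "\<one> \<ominus> r \<otimes> u = t"
    using tr u by (simp add: a_minus_def a_assoc r_neg)
  then show ?thesis using tr(1,2) by metis
qed

text \<open>The class of u in the field K/n is invertible, so an ideal that kills it lies in n;
  maximality of m then gives equality.\<close>

lemma maximal_submodule_eq:
  assumes m: "maximal_submodule m K (left_regular K)" and n: "maximal_submodule n K (left_regular K)"
    and u: "u \<in> carrier K" "u \<notin> n" and mu: "\<And>a. a \<in> m \<Longrightarrow> a \<otimes> u \<in> n"
  shows "m = n"
proof -
  have sub: "submodule m K (left_regular K)" "submodule n K (left_regular K)"
    using m n by (auto simp: maximal_submodule_def)
  obtain r where r: "r \<in> carrier K" "\<one> \<ominus> r \<otimes> u \<in> n"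
    using maximal_submodule_unit[OF n u] by blast
  have "m \<subseteq> n"
  proof
    fix a assume a: "a \<in> m"
    then have ac: "a \<in> carrier K" using regular.submodule_carrier[OF sub(1)] by simp
    have "a = a \<otimes> (\<one> \<ominus> r \<otimes> u) \<oplus> r \<otimes> (a \<otimes> u)"
      using ac r u by algebra
    moreover have "a \<otimes> (\<one> \<ominus> r \<otimes> u) \<in> n" "r \<otimes> (a \<otimes> u) \<in> n"
      using regular.submodule_smult[OF sub(2)] ac r mu[OF a] by auto
    ultimately show "a \<in> n" using regular.submoduleE(5)[OF sub(2)] by (metis left_regular_simps(3))
  qed
  then show ?thesis using m n unfolding maximal_submodule_def by auto
qed

text \<open>A nonzero x killed by m generates a copy of the field K/m, which is simple.\<close>

lemma annihilator_subset_socle: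
  assumes m: "maximal_submodule m K (left_regular K)"
  shows "annihilator m \<subseteq> socle K (left_regular K)"
proof
  fix x assume "x \<in> annihilator m"
  then have x: "x \<in> carrier K" "\<And>a. a \<in> m \<Longrightarrow> a \<otimes> x = \<zero>" by (auto simp: annihilator_def)
  let ?C = "cyclic_submodule K (left_regular K) x"
  have xC: "x \<in> ?C" using regular.generator_mem_cyclic[of x] x by simp
  show "x \<in> socle K (left_regular K)"
  proof (cases "x = \<zero>")
    case True
    then show ?thesis
      using generate.one[of "add_monoid (left_regular K)"] by (simp add: socle_def)
  next
    case False
    have "simple_submodule ?C K (left_regular K)"
      unfolding simple_submodule_def
    proof (intro conjI allI impI)
      show "submodule ?C K (left_regular K)" using regular.submodule_cyclic[of x] x by simp
      show "?C \<noteq> {\<zero>\<^bsub>left_regular K\<^esub>}" using False xC by auto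
      fix L assume L: "submodule L K (left_regular K) \<and> L \<subseteq> ?C"
      show "L = {\<zero>\<^bsub>left_regular K\<^esub>} \<or> L = ?C"
      proof (rule disjCI)
        assume "L \<noteq> ?C"
        show "L = {\<zero>\<^bsub>left_regular K\<^esub>}"
        proof (rule ccontr)
          assume "L \<noteq> {\<zero>\<^bsub>left_regular K\<^esub>}"
          then obtain y where y: "y \<in> L" "y \<noteq> \<zero>" using regular.submodule_zero L by auto
          then obtain a where a: "a \<in> carrier K" "y = a \<otimes> x"
            using L unfolding regular.mem_cyclic_submodule subset_iff left_regular_simps by blast
          then have "a \<notin> m" using x y by blast
          then obtain r where r: "r \<in> carrier K" "\<one> \<ominus> r \<otimes> a \<in> m"
            using maximal_submodule_unit[OF m] a by blast
          \<comment> \<open>The first summand vanishes, as 1 - r a lies in m and m kills x; thus x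
            is recovered from y = a x.\<close>
          have "x = (\<one> \<ominus> r \<otimes> a) \<otimes> x \<oplus> r \<otimes> (a \<otimes> x)" using x(1) a(1) r(1) by algebra
          then have "x = r \<otimes> y" using x r a by simp
          then have "x \<in> L" using regular.submodule_smult[of L r y] L r y by simp
          then show False using regular.cyclic_submodule_least L \<open>L \<noteq> ?C\<close> by blast
        qed
      qed
    qed
    then show ?thesis using xC unfolding socle_def by (auto intro: generate.incl)
  qed
qed

lemma jacobson_radical_submodule:
  "submodule (jacobson_radical K) K (left_regular K)"
  by (rule regular.submoduleI)
    (auto simp: jacobson_radical_def maximal_submodule_def regular.submodule_zero
      dest: regular.submoduleE[simplified] regular.submodule_zero)

text \<open>
  An isomorphism \<open>Soc K \<rightarrow> K/J\<close> maps \<open>ann m\<close> into the elements of \<open>K/J\<close> killed by \<open>m\<close>; these form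
  the \<open>m\<close>-component of \<open>K/J\<close>, a copy of the field \<open>K/m\<close>.
\<close>

lemma annihilator_maximal_cyclic:
  assumes m: "maximal_submodule m K (left_regular K)"
    and x: "x \<in> annihilator m" "x \<noteq> \<zero>" and y: "y \<in> annihilator m"
  shows "\<exists>r\<in>carrier K. y = r \<otimes> x"
proof -
  let ?L = "left_regular K" and ?J = "jacobson_radical K" and ?S = "socle K (left_regular K)"
  have J: "submodule ?J K ?L" by (rule jacobson_radical_submodule)
  interpret J: abelian_subgroup ?J ?L
    by (rule abelian_subgroupI3)
      (use J submodule.axioms(1) regular.abelian_group_axioms in
        \<open>auto intro: additive_subgroup.intro\<close>)
  obtain s where s: "s \<in> module_isos K (?L\<lparr>carrier := ?S\<rparr>) (quotient_module ?L ?J)"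
    using frobenius unfolding frobenius_ring_def by blast
  have inj: "inj_on s ?S"
    and coset: "\<And>z. z \<in> ?S \<Longrightarrow> s z \<in> a_rcosets\<^bsub>?L\<^esub> ?J"
    and smult: "\<And>a z. a \<in> carrier K \<Longrightarrow> z \<in> ?S \<Longrightarrow> s (a \<otimes> z) = ?J <+>\<^bsub>?L\<^esub> ((\<lambda>x. a \<otimes> x) ` s z)"
    using s by (auto simp: module_isos_def module_homs_def quotient_module_def bij_betw_def)
  have rep: "\<exists>u\<in>carrier K. u \<in> s z \<and> s z = ?J +>\<^bsub>?L\<^esub> u" if "z \<in> ?S" for z
    using coset[OF that] J.a_rcos_self by (auto simp: A_RCOSETS_def')
  have coset_eq: "s z = ?J +>\<^bsub>?L\<^esub> v" if "z \<in> ?S" "v \<in> s z" for z v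
    using rep[OF that(1)] that(2) regular.M.a_repr_independence[OF _ _ J.a_subgroup] by auto
  have mem_smult: "a \<otimes> u \<in> s (a \<otimes> z)" if "a \<in> carrier K" "z \<in> ?S" "u \<in> s z" for a z u
  proof -
    have "u \<in> carrier K"
      using coset[OF that(2)] that(3) J.a_rcosets_part_G by auto
    then have "a \<otimes> u = \<zero>\<^bsub>?L\<^esub> \<oplus>\<^bsub>?L\<^esub> a \<otimes> u" using that by simp
    moreover have "a \<otimes> u \<in> (\<lambda>x. a \<otimes> x) ` s z" using that(3) by (rule imageI)
    ultimately have "a \<otimes> u \<in> ?J <+>\<^bsub>?L\<^esub> ((\<lambda>x. a \<otimes> x) ` s z)"
      unfolding regular.mem_set_add using regular.submodule_zero[OF J] by metis
    then show ?thesis by (simp only: smult[OF that(1,2)])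
  qed
  have S: "x \<in> ?S" "y \<in> ?S" using x y annihilator_subset_socle[OF m] by auto
  have car: "x \<in> carrier K" "y \<in> carrier K" using x y by (auto simp: annihilator_def)
  obtain u v where u: "u \<in> carrier K" "u \<in> s x" and v: "v \<in> carrier K" "v \<in> s y"
    using rep[OF S(1)] rep[OF S(2)] by blast
  have zero: "\<zero> \<in> annihilator m" "\<zero> \<in> ?S"
  proof -
    show "\<zero> \<in> annihilator m"
      using m regular.submodule_carrier by (auto simp: annihilator_def maximal_submodule_def)
    then show "\<zero> \<in> ?S" using annihilator_subset_socle[OF m] by blast
  qed
  have "\<zero> \<in> s \<zero>" using mem_smult[OF zero_closed S(1) u(2)] u(1) car by simp
  then have s0: "s \<zero> = ?J +>\<^bsub>?L\<^esub> \<zero>" using coset_eq zero by blast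
  have J0: "w \<in> ?J +>\<^bsub>?L\<^esub> \<zero> \<longleftrightarrow> w \<in> ?J" for w
    using regular.submodule_carrier[OF J] by (auto simp: a_r_coset_def')
  have "u \<notin> ?J"
  proof
    assume "u \<in> ?J"
    then have "u \<in> s \<zero>" using J0 s0 by simp
    then have "s \<zero> = s x" using coset_eq[OF zero(2)] coset_eq[OF S(1) u(2)] by blast
    then show False using inj zero(2) S(1) x(2) by (auto dest: inj_onD)
  qed
  have mJ: "a \<otimes> w \<in> ?J" if a: "a \<in> m" and z: "z \<in> annihilator m" and w: "w \<in> s z" for a z w
  proof -
    have "a \<in> carrier K"
      using a m regular.submodule_carrier by (auto simp: maximal_submodule_def)
    moreover have "z \<in> ?S" using z annihilator_subset_socle[OF m] by blast
    ultimately have "a \<otimes> w \<in> s (a \<otimes> z)" using mem_smult w by blast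
    then show ?thesis using a z s0 J0 by (simp add: annihilator_def)
  qed
  \<comment> \<open>Since m u lies in J, hence in every maximal ideal, a maximal ideal that misses u
    can only be m: the class of u lives in the m-component of K/J.\<close>
  obtain n where n: "maximal_submodule n K ?L" "u \<notin> n"
    using \<open>u \<notin> ?J\<close> u(1) by (auto simp: jacobson_radical_def)
  have "?J \<subseteq> n" using n(1) by (auto simp: jacobson_radical_def)
  then have "m = n" using maximal_submodule_eq[OF m n(1) u(1) n(2)] mJ[OF _ x(1) u(2)] by blast
  then obtain r where r: "r \<in> carrier K" "\<one> \<ominus> r \<otimes> u \<in> m"
    using maximal_submodule_unit[OF n(1) u(1) n(2)] by blast
  \<comment> \<open>As r is an inverse of u modulo m and m v lies in J, the classes of v and (r v) u
    in K/J agree. So \<open>s\<close> sends (r v) x and y to the same coset, and its injectivity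
    gives y = (r v) x.\<close>
  let ?z = "(r \<otimes> v) \<otimes> x"
  have "?z \<in> annihilator m"
  proof -
    have "a \<otimes> ?z = (r \<otimes> v) \<otimes> (a \<otimes> x)" if "a \<in> carrier K" for a
      using that r(1) v(1) car(1) by algebra
    then show ?thesis
      using m x(1) r(1) v(1) car(1) regular.submodule_carrier
      by (auto simp: annihilator_def maximal_submodule_def)
  qed
  then have z: "?z \<in> ?S" using annihilator_subset_socle[OF m] by blast
  have "(r \<otimes> v) \<otimes> u \<in> s ?z" using mem_smult[OF _ S(1) u(2)] r v by simp
  then have "s ?z = ?J +>\<^bsub>?L\<^esub> ((r \<otimes> v) \<otimes> u)" using coset_eq[OF z] by blast
  moreover have "v = (\<one> \<ominus> r \<otimes> u) \<otimes> v \<oplus> (r \<otimes> v) \<otimes> u" using r(1) u(1) v(1) by algebra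
  then have "v \<in> ?J +>\<^bsub>?L\<^esub> ((r \<otimes> v) \<otimes> u)"
    using mJ[OF r(2) y v(2)] by (auto simp: a_r_coset_def')
  ultimately have "s ?z = s y" using coset_eq[OF z] coset_eq[OF S(2) v(2)] by blast
  then have "?z = y" using inj z S(2) by (auto dest: inj_onD)
  then show ?thesis using r(1) v(1) by auto
qed

end

section \<open>Minimal submodules, kernels and images\<close>

lemma module_length_le_one:
  assumes "\<And>S. submodule S A M \<Longrightarrow> N \<subset> S \<Longrightarrow> S \<subseteq> L \<Longrightarrow> S = L"
  shows "module_length A M N L \<le> 1"
  unfolding module_length_def
proof (rule chain_length_least)
  fix n S assume "chain_to {S. submodule S A M \<and> N \<subseteq> S \<and> S \<subseteq> L} n S"
  then have "n = 0 \<or> n = 1 \<and> S = L"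
  proof (induction rule: chain_to.induct)
    case (chain_to_step n S T)
    have "S = L \<Longrightarrow> \<not> S \<subset> T" using chain_to_step(2) by blast
    moreover have "T = L"
      using assms[of T] chain_to_mem[OF chain_to_step(1)] chain_to_step(2,3) by blast
    ultimately show ?case using chain_to_step by auto
  qed simp
  then show "enat n \<le> 1" by (auto simp: one_enat_def)
qed

text \<open>Since descending sequences become stationary, strict inclusion of submodules is well
  founded.\<close>

lemma artinian_module_minimal:
  assumes art: "artinian_module A M" and N: "submodule N A M" "P N"
  obtains I where "submodule I A M" "P I"
    "\<And>L. submodule L A M \<Longrightarrow> L \<subset> I \<Longrightarrow> \<not> P L"
proof -
  let ?r = "{(L, I). submodule L A M \<and> submodule I A M \<and> L \<subset> I}"
  have "wf ?r"
    unfolding wf_iff_no_infinite_down_chain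
  proof
    assume "\<exists>f. \<forall>i. (f (Suc i), f i) \<in> ?r"
    then obtain f where "\<forall>i. (f (Suc i), f i) \<in> ?r" by blast
    then have f: "\<And>i. submodule (f i) A M \<and> f (Suc i) \<subset> f i" by simp
    then have "\<exists>m. \<forall>n\<ge>m. f n = f m"
      using art unfolding artinian_module_def by (metis psubset_imp_subset)
    then show False using f by (metis le_SucI order_refl psubset_eq)
  qed
  then obtain I where "I \<in> {I. submodule I A M \<and> P I}"
    "\<And>L. (L, I) \<in> ?r \<Longrightarrow> L \<notin> {I. submodule I A M \<and> P I}"
    by (rule wfE_min[of ?r N "{I. submodule I A M \<and> P I}"]) (use N in auto)
  then show thesis using that by auto
qed

text \<open>Homomorphisms defined on a submodule \<open>N\<close> of an ambient module. Lengths are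
  read off the submodules of \<open>M\<close>, so restricting a map, for instance evaluation to a
  kernel, must not change the module in which lengths are computed.\<close>

locale partial_linear_map = M: module K M + P: module K P
  for K (structure) and M :: "('a, 'b, 'n) module_scheme" and P :: "('a, 'c, 'p) module_scheme" +
  fixes N :: "'b set" and f :: "'b \<Rightarrow> 'c"
  assumes domain: "submodule N K M"
    and map_closed: "x \<in> N \<Longrightarrow> f x \<in> carrier P"
    and map_add: "x \<in> N \<Longrightarrow> y \<in> N \<Longrightarrow> f (x \<oplus>\<^bsub>M\<^esub> y) = f x \<oplus>\<^bsub>P\<^esub> f y"
    and map_smult: "a \<in> carrier K \<Longrightarrow> x \<in> N \<Longrightarrow> f (a \<odot>\<^bsub>M\<^esub> x) = a \<odot>\<^bsub>P\<^esub> f x"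
begin

lemma map_zero [simp]: "f \<zero>\<^bsub>M\<^esub> = \<zero>\<^bsub>P\<^esub>"
  using map_smult[of \<zero> "\<zero>\<^bsub>M\<^esub>"] map_closed M.submodule_zero[OF domain] by simp

lemma map_minus: "x \<in> N \<Longrightarrow> f (\<ominus>\<^bsub>M\<^esub> x) = \<ominus>\<^bsub>P\<^esub> f x"
  using map_smult[of "\<ominus> \<one>" x] map_closed[of x] M.submodule_carrier[OF domain, of x]
  by (simp add: M.smult_l_minus P.smult_l_minus)

lemma image_submodule:
  assumes S: "submodule S K M" "S \<subseteq> N"
  shows "submodule (f ` S) K P"
proof (rule P.submoduleI)
  have sub: "x \<in> N" if "x \<in> S" for x using that S by blast
  show "f ` S \<subseteq> carrier P" using map_closed S by blast
  show "\<zero>\<^bsub>P\<^esub> \<in> f ` S" using M.submodule_zero[OF S(1)] by (metis imageI map_zero)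
  show "\<ominus>\<^bsub>P\<^esub> a \<in> f ` S" if "a \<in> f ` S" for a
    using that sub M.submoduleE(3)[OF S(1)] by (force simp flip: map_minus)
  show "a \<oplus>\<^bsub>P\<^esub> b \<in> f ` S" if "a \<in> f ` S" "b \<in> f ` S" for a b
    using that sub M.submoduleE(5)[OF S(1)] by (force simp flip: map_add)
  show "a \<odot>\<^bsub>P\<^esub> x \<in> f ` S" if "a \<in> carrier K" "x \<in> f ` S" for a x
    using that sub M.submodule_smult[OF S(1)] by (force simp flip: map_smult)
qed

lemma preimage_submodule:
  assumes "submodule T K P"
  shows "submodule {x \<in> N. f x \<in> T} K M"
  by (rule M.submoduleI)
    (auto simp: map_add map_minus map_smult M.submodule_zero[OF domain] P.submodule_zero[OF assms]
      M.submodule_carrier[OF domain] M.submoduleE[OF domain] P.submoduleE[OF assms])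

text \<open>Taking images is strictly monotone on the submodules that contain the kernel. This is
  the half of the isomorphism between N/ker f and f(N) that bounds the length of the image from
  below.\<close>

lemma module_length_image:
  "module_length K M {x \<in> N. f x = \<zero>\<^bsub>P\<^esub>} N \<le> module_length K P {\<zero>\<^bsub>P\<^esub>} (f ` N)"
proof (rule module_length_image_le[where f = "\<lambda>S. f ` S"])
  fix S assume "submodule S K M" "S \<subseteq> N"
  then show "submodule (f ` S) K P \<and> {\<zero>\<^bsub>P\<^esub>} \<subseteq> f ` S \<and> f ` S \<subseteq> f ` N"
    using image_submodule P.submodule_zero by blast
next
  fix S T assume S: "submodule S K M" and T: "submodule T K M" and
    ker: "{x \<in> N. f x = \<zero>\<^bsub>P\<^esub>} \<subseteq> S" and TN: "T \<subseteq> N" and ST: "S \<subset> T"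
  obtain t where t: "t \<in> T" "t \<notin> S" using ST by blast
  have "f t \<notin> f ` S"
  proof
    assume "f t \<in> f ` S"
    then obtain s where s: "s \<in> S" "f t = f s" by blast
    have N: "s \<in> N" "t \<in> N" using s t TN ST by auto
    have car: "s \<in> carrier M" "t \<in> carrier M" using M.submodule_carrier[OF domain] N by auto
    have "f (\<ominus>\<^bsub>M\<^esub> s \<oplus>\<^bsub>M\<^esub> t) = \<zero>\<^bsub>P\<^esub>"
      using N s map_closed[OF N(1)] M.submoduleE(3)[OF domain N(1)]
      by (simp add: map_add map_minus P.M.l_neg)
    then have "\<ominus>\<^bsub>M\<^esub> s \<oplus>\<^bsub>M\<^esub> t \<in> S"
      using ker N M.submoduleE(3,5)[OF domain] by blast
    then show False
      using t(2) M.submodule_cancel_left[OF S M.submoduleE(3)[OF S s(1)] car(2)] by blast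
  qed
  then show "f ` S \<subset> f ` T" using ST t by blast
qed

text \<open>Because L lies in the image of \<open>f\<close>, distinct submodules of L have distinct
  preimages.\<close>

lemma module_length_preimage:
  assumes "L \<subseteq> f ` N"
  shows "module_length K P A L \<le> module_length K M {x \<in> N. f x \<in> A} {x \<in> N. f x \<in> L}"
proof (rule module_length_image_le[where f = "\<lambda>S. {x \<in> N. f x \<in> S}"])
  fix S assume "submodule S K P" "A \<subseteq> S" "S \<subseteq> L"
  then show "submodule {x \<in> N. f x \<in> S} K M \<and> {x \<in> N. f x \<in> A} \<subseteq> {x \<in> N. f x \<in> S}
      \<and> {x \<in> N. f x \<in> S} \<subseteq> {x \<in> N. f x \<in> L}"
    using preimage_submodule by auto
next
  fix S T assume "S \<subset> T" "T \<subseteq> L"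
  then show "{x \<in> N. f x \<in> S} \<subset> {x \<in> N. f x \<in> T}" using assms by blast
qed

end

section \<open>Finite length of the ring\<close>

context commutative_frobenius
begin

abbreviation ideal_length :: "'a set \<Rightarrow> 'a set \<Rightarrow> enat" where
  "ideal_length \<equiv> module_length K (left_regular K)"

text \<open>Each nonzero element of ann m generates all of it, so a nonzero submodule of I is
  already I.\<close>

lemma annihilator_maximal_length:
  assumes m: "maximal_submodule m K (left_regular K)" and I: "I \<subseteq> annihilator m"
  shows "ideal_length {\<zero>} I \<le> 1"
proof (rule module_length_le_one)
  fix S assume S: "submodule S K (left_regular K)" "{\<zero>} \<subset> S" "S \<subseteq> I"
  then obtain x where x: "x \<in> S" "x \<noteq> \<zero>" by blast
  have "y \<in> S" if "y \<in> I" for y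
  proof -
    have "x \<in> annihilator m" "y \<in> annihilator m" using x S(3) I \<open>y \<in> I\<close> by auto
    then obtain r where "r \<in> carrier K" "y = r \<otimes> x"
      using annihilator_maximal_cyclic[OF m _ x(2)] by blast
    then show ?thesis using regular.submodule_smult[OF S(1) _ x(1)] by simp
  qed
  then show "S = I" using S by blast
qed

text \<open>
  An ideal \<open>I\<close> minimal among those of infinite length satisfies \<open>a I = I\<close> or \<open>a I = 0\<close> for every \<open>a\<close>,
  hence its annihilator is maximal and \<open>I\<close> is at most simple.
\<close>

lemma finite_length: "ideal_length {\<zero>} (carrier K) \<noteq> \<infinity>"
proof
  let ?L = "left_regular K"
  assume "ideal_length {\<zero>} (carrier K) = \<infinity>"
  moreover have art: "artinian_module K ?L" using frobenius by (simp add: frobenius_ring_def)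
  ultimately obtain I where I: "submodule I K ?L" "ideal_length {\<zero>} I = \<infinity>"
    and min: "\<And>L. submodule L K ?L \<Longrightarrow> L \<subset> I \<Longrightarrow> ideal_length {\<zero>} L \<noteq> \<infinity>"
    using artinian_module_minimal[OF art regular.carrier_is_submodule, of "\<lambda>I. ideal_length {\<zero>} I = \<infinity>"]
    by auto
  have car: "x \<in> carrier K" if "x \<in> I" for x using regular.submodule_carrier[OF I(1)] that by simp
  define p where "p = {a \<in> carrier K. \<forall>x\<in>I. a \<otimes> x = \<zero>}"
  \<comment> \<open>The kernel of multiplication by a on I is a proper subideal, so it has finite
    length. The image a I then has infinite length, and minimality of I forbids it to be smaller
    than I.\<close>
  have mult_surj: "(\<lambda>x. a \<otimes> x) ` I = I" if a: "a \<in> carrier K" "a \<notin> p" for a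
  proof -
    interpret f: partial_linear_map K ?L ?L I "\<lambda>x. a \<otimes> x"
      by (intro partial_linear_map.intro partial_linear_map_axioms.intro left_regular_module)
        (use I(1) a car in \<open>simp_all add: r_distr m_lcomm\<close>)
    let ?ker = "{x \<in> I. a \<otimes> x = \<zero>}"
    have ker: "submodule ?ker K ?L"
      using f.preimage_submodule[OF regular.submodule_singleton_zero] by simp
    have "?ker \<subset> I" using a by (auto simp: p_def)
    then have fin: "ideal_length {\<zero>} ?ker \<noteq> \<infinity>" using min ker by blast
    have "ideal_length {\<zero>} I = ideal_length {\<zero>} ?ker + ideal_length ?ker I"
      using regular.module_length_add[of "{\<zero>}" ?ker I] regular.submodule_singleton_zero ker I
        regular.submodule_zero[OF I(1)] a(1) by auto
    then have "ideal_length ?ker I = \<infinity>"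
      using fin unfolding I(2) by (cases "ideal_length {\<zero>} ?ker"; cases "ideal_length ?ker I") simp_all
    then have "ideal_length {\<zero>} ((\<lambda>x. a \<otimes> x) ` I) = \<infinity>"
      using f.module_length_image by (simp only: left_regular_simps enat_ord_simps)
    moreover have "(\<lambda>x. a \<otimes> x) ` I \<subseteq> I"
      using regular.submodule_smult[OF I(1) a(1)] by auto
    ultimately show ?thesis using min f.image_submodule[OF I(1)] by blast
  qed
  have "I \<noteq> {\<zero>}" using I(2) by auto
  then obtain x0 where x0: "x0 \<in> I" "x0 \<noteq> \<zero>" using regular.submodule_zero[OF I(1)] by auto
  have p: "submodule p K ?L"
    by (rule regular.submoduleI) (auto simp: p_def car l_distr l_minus m_assoc)
  have "maximal_submodule p K ?L"
    unfolding maximal_submodule_def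
  proof (intro conjI allI impI)
    show "submodule p K ?L" by (rule p)
    show "p \<noteq> carrier ?L" using x0 car by (auto simp: p_def set_eq_iff intro!: exI[of _ \<one>])
    fix L assume L: "submodule L K ?L \<and> p \<subseteq> L"
    show "L = p \<or> L = carrier ?L"
    proof (rule disjCI)
      assume "L \<noteq> carrier ?L"
      show "L = p"
      proof (rule ccontr)
        assume "L \<noteq> p"
        then obtain a where a: "a \<in> L" "a \<notin> p" using L by blast
        then have ac: "a \<in> carrier K" using L regular.submodule_carrier by auto
        \<comment> \<open>Among the c with c I = I one is taken whose principal ideal Kc is minimal.
          Then c a qualifies too, so Kca, being contained in Kc, equals it, and c = b c a. Hence 1 -
          b a kills c I = I and lies in p, which puts 1 into L.\<close>
        let ?P = "\<lambda>C. \<exists>c\<in>carrier K. C = cyclic_submodule K ?L c \<and> (\<lambda>x. c \<otimes> x) ` I = I"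
        have "?P (cyclic_submodule K ?L a)" using ac mult_surj a by blast
        then obtain c where c: "c \<in> carrier K" "(\<lambda>x. c \<otimes> x) ` I = I"
          and min_c: "\<And>C. submodule C K ?L \<Longrightarrow> C \<subset> cyclic_submodule K ?L c \<Longrightarrow> \<not> ?P C"
          using artinian_module_minimal[OF art, of "cyclic_submodule K ?L a" ?P]
            regular.submodule_cyclic[of a] ac by (metis left_regular_simps(1))
        have "(\<lambda>x. (c \<otimes> a) \<otimes> x) ` I = (\<lambda>x. c \<otimes> x) ` (\<lambda>x. a \<otimes> x) ` I"
          using c ac car by (auto simp: m_assoc image_image)
        then have "(\<lambda>x. (c \<otimes> a) \<otimes> x) ` I = I" using mult_surj[OF ac a(2)] c(2) by simp
        then have P: "?P (cyclic_submodule K ?L (c \<otimes> a))" using c(1) ac by blast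
        have sub: "submodule (cyclic_submodule K ?L (c \<otimes> a)) K ?L"
          using regular.submodule_cyclic[of "c \<otimes> a"] c ac by simp
        have "c \<otimes> a \<in> cyclic_submodule K ?L c"
          using c(1) ac by (auto simp: regular.mem_cyclic_submodule m_comm)
        then have "cyclic_submodule K ?L (c \<otimes> a) \<subseteq> cyclic_submodule K ?L c"
          using regular.cyclic_submodule_least[OF regular.submodule_cyclic] c by simp
        then have "cyclic_submodule K ?L (c \<otimes> a) = cyclic_submodule K ?L c"
          using min_c[OF sub] P by blast
        then have "c \<in> cyclic_submodule K ?L (c \<otimes> a)"
          using regular.generator_mem_cyclic[of c] c by simp
        then obtain b where b: "b \<in> carrier K" "c = b \<otimes> (c \<otimes> a)"
          by (auto simp: regular.mem_cyclic_submodule)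
        have "(\<one> \<ominus> b \<otimes> a) \<otimes> x = \<zero>" if "x \<in> I" for x
        proof -
          obtain y where y: "y \<in> I" "x = c \<otimes> y" using c(2) \<open>x \<in> I\<close> by (metis imageE)
          have "(\<one> \<ominus> b \<otimes> a) \<otimes> (c \<otimes> y) = (c \<ominus> b \<otimes> (c \<otimes> a)) \<otimes> y"
            using b(1) ac c(1) car[OF y(1)] by algebra
          then show ?thesis using b(2) y c(1) car[OF y(1)] by (simp add: a_minus_def r_neg)
        qed
        then have "\<one> \<ominus> b \<otimes> a \<in> L" using L b(1) ac by (auto simp: p_def)
        moreover have "b \<otimes> a \<in> L" using L regular.submodule_smult[of L b a] a b(1) by simp
        moreover have "\<one> = (\<one> \<ominus> b \<otimes> a) \<oplus> b \<otimes> a" using b(1) ac by algebra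
        ultimately have "\<one> \<in> L" using L regular.submoduleE(5)[of L] by (metis left_regular_simps(3))
        then have "y \<in> L" if "y \<in> carrier K" for y
          using L regular.submodule_smult[of L y \<one>] that by simp
        then show False using \<open>L \<noteq> carrier ?L\<close> L regular.submoduleE(1)[of L] by auto
      qed
    qed
  qed
  moreover have "I \<subseteq> annihilator p" using car by (auto simp: p_def annihilator_def)
  ultimately have "ideal_length {\<zero>} I \<le> 1" by (rule annihilator_maximal_length)
  then show False using I(2) by (simp add: one_enat_def)
qed

end

section \<open>Pairings and orthogonal submodules\<close>

text \<open>
  The pairing only has to be defined on a submodule \<open>B\<close> of \<open>M\<close>, so that a submodule can be paired
  with its own dual without changing the ambient module.
\<close>

locale frobenius_pairing = commutative_frobenius K + M: module K M + P: module K P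
  for K :: "('a, 'm) ring_scheme" (structure) and M :: "('a, 'b, 'n) module_scheme" and P :: "('a, 'c, 'p) module_scheme" +
  fixes B :: "'b set" and \<beta> :: "'b \<Rightarrow> 'c \<Rightarrow> 'a"
  assumes domain: "submodule B K M"
    and pair_closed: "x \<in> B \<Longrightarrow> p \<in> carrier P \<Longrightarrow> \<beta> x p \<in> carrier K"
    and pair_add_left: "x \<in> B \<Longrightarrow> y \<in> B \<Longrightarrow> p \<in> carrier P \<Longrightarrow> \<beta> (x \<oplus>\<^bsub>M\<^esub> y) p = \<beta> x p \<oplus> \<beta> y p"
    and pair_smult_left: "a \<in> carrier K \<Longrightarrow> x \<in> B \<Longrightarrow> p \<in> carrier P \<Longrightarrow> \<beta> (a \<odot>\<^bsub>M\<^esub> x) p = a \<otimes> \<beta> x p"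
    and pair_add_right: "x \<in> B \<Longrightarrow> p \<in> carrier P \<Longrightarrow> q \<in> carrier P \<Longrightarrow> \<beta> x (p \<oplus>\<^bsub>P\<^esub> q) = \<beta> x p \<oplus> \<beta> x q"
    and pair_smult_right: "a \<in> carrier K \<Longrightarrow> x \<in> B \<Longrightarrow> p \<in> carrier P \<Longrightarrow> \<beta> x (a \<odot>\<^bsub>P\<^esub> p) = a \<otimes> \<beta> x p"
begin

definition perp :: "'b set \<Rightarrow> 'c set" where
  "perp N = {p \<in> carrier P. \<forall>x\<in>N. \<beta> x p = \<zero>}"

lemma perp_anti: "N \<subseteq> N' \<Longrightarrow> perp N' \<subseteq> perp N"
  by (auto simp: perp_def)

lemma pair_zero_right: "x \<in> B \<Longrightarrow> \<beta> x \<zero>\<^bsub>P\<^esub> = \<zero>"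
  using pair_smult_right[of \<zero> x "\<zero>\<^bsub>P\<^esub>"] pair_closed by simp

lemma pair_zero_left: "p \<in> carrier P \<Longrightarrow> \<beta> \<zero>\<^bsub>M\<^esub> p = \<zero>"
  using pair_smult_left[of \<zero> "\<zero>\<^bsub>M\<^esub>" p] pair_closed M.submodule_zero[OF domain] by simp

lemma pair_minus_right: "x \<in> B \<Longrightarrow> p \<in> carrier P \<Longrightarrow> \<beta> x (\<ominus>\<^bsub>P\<^esub> p) = \<ominus> \<beta> x p"
  using pair_smult_right[of "\<ominus> \<one>" x p] pair_closed[of x p]
  by (simp add: P.smult_l_minus l_minus)

lemma perp_zero: "perp {\<zero>\<^bsub>M\<^esub>} = carrier P"
  by (auto simp: perp_def pair_zero_left)

lemma perp_submodule:
  assumes "N \<subseteq> B"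
  shows "submodule (perp N) K P"
proof -
  have "x \<in> B" if "x \<in> N" for x using assms that by blast
  then show ?thesis
    by (intro P.submoduleI)
      (auto simp: perp_def pair_zero_right pair_minus_right pair_add_right pair_smult_right)
qed

text \<open>The simple quotient N'/N is a copy of K/m with m = (N : y). Evaluation p -> \<beta> y p
  embeds perp N modulo perp N' into ann m, where any nonzero element generates; here the socle
  hypothesis controls the length of a dual.\<close>

lemma module_length_perp_cover:
  assumes N: "submodule N K M" and N': "submodule N' K M" "N \<subset> N'" "N' \<subseteq> B"
    and cover: "\<And>S. submodule S K M \<Longrightarrow> N \<subset> S \<Longrightarrow> S \<subseteq> N' \<Longrightarrow> S = N'"
  shows "module_length K P (perp N') (perp N) \<le> 1"
proof (rule module_length_le_one)
  fix L assume L: "submodule L K P" "perp N' \<subset> L" "L \<subseteq> perp N"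
  obtain y where y: "y \<in> N'" "y \<notin> N" using N' by blast
  have yM: "y \<in> carrier M" using M.submodule_carrier[OF N'(1) y(1)] .
  have yB: "y \<in> B" using y N' by blast
  \<comment> \<open>For z outside N the submodule N + Kz lies strictly above N, so the cover
    condition makes it all of N'.\<close>
  have gen: "\<exists>n\<in>N. \<exists>a\<in>carrier K. x = n \<oplus>\<^bsub>M\<^esub> a \<odot>\<^bsub>M\<^esub> z"
    if "x \<in> N'" and z: "z \<in> N'" "z \<notin> N" for x z
  proof -
    have zM: "z \<in> carrier M" using M.submodule_carrier[OF N'(1) z(1)] .
    let ?C = "cyclic_submodule K M z"
    have C: "submodule ?C K M" by (rule M.submodule_cyclic[OF zM])
    have "z \<in> N <+>\<^bsub>M\<^esub> ?C"
      using M.set_add_upper(2)[OF N C] M.generator_mem_cyclic[OF zM] by blast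
    moreover have "N <+>\<^bsub>M\<^esub> ?C \<subseteq> N'"
      using N' z M.cyclic_submodule_least by (intro M.set_add_least) auto
    ultimately have "N <+>\<^bsub>M\<^esub> ?C = N'"
      using cover M.submodule_set_add[OF N C] M.set_add_upper(1)[OF N C] z by blast
    then have "x \<in> N <+>\<^bsub>M\<^esub> ?C" using \<open>x \<in> N'\<close> by simp
    then obtain n c where "n \<in> N" "c \<in> ?C" "x = n \<oplus>\<^bsub>M\<^esub> c" unfolding M.mem_set_add by blast
    then show ?thesis unfolding M.mem_cyclic_submodule by blast
  qed
  define m where "m = {a \<in> carrier K. a \<odot>\<^bsub>M\<^esub> y \<in> N}"
  have m: "submodule m K (left_regular K)"
    unfolding m_def by (rule M.transporter_submodule[OF N yM])
  have max: "maximal_submodule m K (left_regular K)"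
    unfolding maximal_submodule_def
  proof (intro conjI allI impI)
    show "m \<noteq> carrier (left_regular K)"
      using y yM by (auto simp: m_def set_eq_iff intro!: exI[of _ \<one>])
    fix J assume J: "submodule J K (left_regular K) \<and> m \<subseteq> J"
    show "J = m \<or> J = carrier (left_regular K)"
    proof (unfold disj_imp, rule impI)
      assume "J \<noteq> m"
      then obtain a where a: "a \<in> J" "a \<notin> m" using J by blast
      have ac: "a \<in> carrier K" using J a regular.submodule_carrier by auto
      then have "a \<odot>\<^bsub>M\<^esub> y \<in> N'" "a \<odot>\<^bsub>M\<^esub> y \<notin> N"
        using a y M.submodule_smult[OF N'(1)] by (auto simp: m_def)
      then obtain n r where nr: "n \<in> N" "r \<in> carrier K" "y = n \<oplus>\<^bsub>M\<^esub> r \<odot>\<^bsub>M\<^esub> (a \<odot>\<^bsub>M\<^esub> y)"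
        using gen[OF y(1)] by blast
      have nM: "n \<in> carrier M" using M.submodule_carrier[OF N nr(1)] .
      have "(\<one> \<ominus> r \<otimes> a) \<odot>\<^bsub>M\<^esub> y = y \<ominus>\<^bsub>M\<^esub> r \<odot>\<^bsub>M\<^esub> (a \<odot>\<^bsub>M\<^esub> y)"
        using nr(2) ac yM
        by (simp add: a_minus_def M.smult_l_distr M.smult_l_minus M.smult_assoc1)
      also have "\<dots> = n \<oplus>\<^bsub>M\<^esub> r \<odot>\<^bsub>M\<^esub> (a \<odot>\<^bsub>M\<^esub> y) \<ominus>\<^bsub>M\<^esub> r \<odot>\<^bsub>M\<^esub> (a \<odot>\<^bsub>M\<^esub> y)"
        using nr(3) by simp
      also have "\<dots> = n"
        using nM nr(2) ac yM by (simp add: a_minus_def M.M.a_assoc M.M.r_neg)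
      finally have "\<one> \<ominus> r \<otimes> a \<in> m" using nr ac by (simp add: m_def)
      then have "\<one> \<ominus> r \<otimes> a \<in> J" using J by blast
      moreover have "r \<otimes> a \<in> J" using J regular.submodule_smult[of J r a] a nr by simp
      moreover have "\<one> = (\<one> \<ominus> r \<otimes> a) \<oplus> r \<otimes> a" using nr(2) ac by algebra
      ultimately have "\<one> \<in> J" using J regular.submoduleE(5)[of J] by (metis left_regular_simps(3))
      then have "x \<in> J" if "x \<in> carrier K" for x
        using J regular.submodule_smult[of J x \<one>] that by simp
      then show "J = carrier (left_regular K)" using J regular.submoduleE(1)[of J] by auto
    qed
  qed (rule m)
  have pair_ann: "\<beta> y p \<in> annihilator m" if "p \<in> perp N" for p
  proof -
    have p: "p \<in> carrier P" using that by (simp add: perp_def)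
    have "a \<otimes> \<beta> y p = \<zero>" if "a \<in> m" for a
      using that \<open>p \<in> perp N\<close> pair_smult_left[of a y p] yB p by (auto simp: m_def perp_def)
    then show ?thesis using pair_closed[OF yB p] by (simp add: annihilator_def)
  qed
  have perp_y: "p \<in> perp N'" if p: "p \<in> perp N" "\<beta> y p = \<zero>" for p
  proof -
    have pP: "p \<in> carrier P" using p by (simp add: perp_def)
    have "\<beta> x p = \<zero>" if x: "x \<in> N'" for x
    proof -
      obtain n a where na: "n \<in> N" "a \<in> carrier K" "x = n \<oplus>\<^bsub>M\<^esub> a \<odot>\<^bsub>M\<^esub> y"
        using gen[OF x y] by blast
      have "n \<in> B" "a \<odot>\<^bsub>M\<^esub> y \<in> B"
        using na N' yB M.submodule_smult[OF domain] by auto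
      then have "\<beta> x p = \<beta> n p \<oplus> a \<otimes> \<beta> y p"
        using na pP yB by (simp add: pair_add_left pair_smult_left)
      then show ?thesis using na p by (simp add: perp_def)
    qed
    then show ?thesis using pP by (simp add: perp_def)
  qed
  obtain q where q: "q \<in> L" "q \<notin> perp N'" using L by blast
  then have qN: "q \<in> perp N" using L by blast
  have qP: "q \<in> carrier P" using qN by (simp add: perp_def)
  have q0: "\<beta> y q \<noteq> \<zero>" using perp_y qN q by blast
  have "p \<in> L" if p: "p \<in> perp N" for p
  proof -
    have pP: "p \<in> carrier P" using p by (simp add: perp_def)
    obtain r where r: "r \<in> carrier K" "\<beta> y p = r \<otimes> \<beta> y q"
      using annihilator_maximal_cyclic[OF max pair_ann[OF qN] q0 pair_ann[OF p]] by blast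
    \<comment> \<open>The value of q at y is nonzero, so the value of p at y is r times it. The
      difference p - r q vanishes at y as well as on N, hence on N', and therefore belongs to
      L.\<close>
    let ?d = "\<ominus>\<^bsub>P\<^esub> (r \<odot>\<^bsub>P\<^esub> q) \<oplus>\<^bsub>P\<^esub> p"
    have NB: "N \<subseteq> B" using N' by blast
    have "?d \<in> perp N"
      using perp_submodule[OF NB] p qN r P.submoduleE by metis
    moreover have "\<beta> y ?d = \<zero>"
      using r qP pP yB pair_closed[OF yB qP]
      by (simp add: pair_add_right pair_minus_right pair_smult_right l_neg)
    ultimately have "?d \<in> L" using perp_y L by blast
    moreover have "\<ominus>\<^bsub>P\<^esub> (r \<odot>\<^bsub>P\<^esub> q) \<in> L"
      using P.submoduleE(3,4)[OF L(1)] r q by blast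
    ultimately show ?thesis using P.submodule_cancel_left[OF L(1)] pP by blast
  qed
  then show "L = perp N" using L by blast
qed

text \<open>Induction on the length of N'/N, peeling off a simple bottom layer C/N; for infinite
  length the bound is trivial.\<close>

lemma module_length_perp_le:
  assumes "submodule N K M" "submodule N' K M" "N \<subseteq> N'" "N' \<subseteq> B"
  shows "module_length K P (perp N') (perp N) \<le> module_length K M N N'"
  using assms
proof (induction "module_length K M N N'" arbitrary: N rule: less_induct)
  case less
  let ?l = "module_length K M" and ?lp = "module_length K P"
  show ?case
  proof (cases "N = N' \<or> ?l N N' = \<infinity>")
    case True
    then show ?thesis by auto
  next
    case False
    \<comment> \<open>A simple layer is found by minimising the length over N: \<open>enat\<close>
      is well ordered, and a submodule strictly between N and C would be strictly shorter because
      lengths are finite here.\<close>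
    define Q where "Q = {S. submodule S K M \<and> N \<subset> S \<and> S \<subseteq> N'}"
    have "\<exists>k. \<exists>S\<in>Q. ?l N S = k" using less.prems False by (auto simp: Q_def)
    then obtain k where "\<exists>S\<in>Q. ?l N S = k" "\<And>i. i < k \<Longrightarrow> \<not> (\<exists>S\<in>Q. ?l N S = i)"
      unfolding exists_least_iff[of "\<lambda>k. \<exists>S\<in>Q. ?l N S = k"] by blast
    then obtain C where C: "C \<in> Q" and min: "\<And>S. S \<in> Q \<Longrightarrow> \<not> ?l N S < ?l N C" by blast
    then have Cs: "submodule C K M" "N \<subset> C" "C \<subseteq> N'" by (auto simp: Q_def)
    have add: "?l N N' = ?l N C + ?l C N'"
      using less.prems Cs by (intro M.module_length_add) auto
    have pos: "1 \<le> ?l N C" using less.prems Cs by (intro module_length_pos) auto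
    have fin: "?l N C \<noteq> \<infinity>" "?l C N' \<noteq> \<infinity>"
      using add False plus_eq_infty_iff_enat[of "?l N C" "?l C N'"] by auto
    have "S = C" if S: "submodule S K M" "N \<subset> S" "S \<subseteq> C" for S
    proof (rule ccontr)
      assume "S \<noteq> C"
      then have SC: "S \<subset> C" using S by blast
      have "?l N S \<noteq> \<infinity>"
        using module_length_mono[of N N S C K M] S fin by auto
      then have "?l N S < ?l N C"
        using less.prems S Cs SC by (intro M.module_length_strict_mono) auto
      moreover have "S \<in> Q" using S Cs by (auto simp: Q_def)
      ultimately show False using min by blast
    qed
    then have one: "?lp (perp C) (perp N) \<le> 1"
      using less.prems Cs by (intro module_length_perp_cover) auto
    have "?l C N' < ?l N N'"
      using add pos fin by (cases "?l N C"; cases "?l C N'") (auto simp: one_enat_def)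
    then have IH: "?lp (perp N') (perp C) \<le> ?l C N'"
      using less.hyps[of C] less.prems Cs by blast
    have "?lp (perp N') (perp N) = ?lp (perp N') (perp C) + ?lp (perp C) (perp N)"
      using less.prems Cs by (intro P.module_length_add perp_submodule perp_anti) auto
    also have "\<dots> \<le> ?l C N' + ?l N C"
      using IH one pos by (intro add_mono) (auto intro: order_trans)
    finally show ?thesis by (simp add: add add.commute)
  qed
qed

end

section \<open>Modules of functionals\<close>

text \<open>Shrinking the carrier of \<open>M\<close> encodes the dual of a submodule. The scalars
  are those of \<open>K\<close>, over which lengths are measured, whereas \<open>dual_right\<close>
  and \<open>dual_left\<close> carry the actions of the algebra.\<close>

definition functional_module ::
    "('a, 'm) ring_scheme \<Rightarrow> ('a, 'b, 'n) module_scheme \<Rightarrow> 'b set \<Rightarrow> ('a, 'b \<Rightarrow> 'a) module" where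
  "functional_module K M N =
     \<lparr>carrier = dual K (M\<lparr>carrier := N\<rparr>), monoid.mult = undefined, one = undefined,
      ring.zero = (\<lambda>x\<in>N. \<zero>\<^bsub>K\<^esub>),
      add = (\<lambda>f g. \<lambda>x\<in>N. f x \<oplus>\<^bsub>K\<^esub> g x),
      smult = (\<lambda>a f. \<lambda>x\<in>N. a \<otimes>\<^bsub>K\<^esub> f x)\<rparr>"

lemma functional_module_simps [simp]:
  "carrier (functional_module K M N) = dual K (M\<lparr>carrier := N\<rparr>)"
  "\<zero>\<^bsub>functional_module K M N\<^esub> = (\<lambda>x\<in>N. \<zero>\<^bsub>K\<^esub>)"
  "f \<oplus>\<^bsub>functional_module K M N\<^esub> g = (\<lambda>x\<in>N. f x \<oplus>\<^bsub>K\<^esub> g x)"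
  "a \<odot>\<^bsub>functional_module K M N\<^esub> f = (\<lambda>x\<in>N. a \<otimes>\<^bsub>K\<^esub> f x)"
  by (simp_all add: functional_module_def)

lemma mem_dual:
  "f \<in> dual K (M\<lparr>carrier := N\<rparr>) \<longleftrightarrow>
     f \<in> extensional N \<and> (\<forall>x\<in>N. f x \<in> carrier K) \<and>
     (\<forall>x\<in>N. \<forall>y\<in>N. f (x \<oplus>\<^bsub>M\<^esub> y) = f x \<oplus>\<^bsub>K\<^esub> f y) \<and>
     (\<forall>a\<in>carrier K. \<forall>x\<in>N. f (a \<odot>\<^bsub>M\<^esub> x) = a \<otimes>\<^bsub>K\<^esub> f x)"
  by (auto simp: dual_def module_homs_def PiE_iff)

lemma (in module) functional_module_module:
  assumes N: "submodule N R M"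
  shows "module R (functional_module R M N)"
proof (rule moduleI)
  note closed = submodule_zero[OF N] submoduleE(4,5)[OF N]
  show "abelian_group (functional_module R M N)"
  proof (rule abelian_groupI)
    fix f assume f: "f \<in> carrier (functional_module R M N)"
    let ?g = "\<lambda>x\<in>N. \<ominus> f x"
    have "?g \<in> carrier (functional_module R M N)"
      using f by (auto simp: mem_dual closed R.minus_add R.r_minus)
    moreover have "?g \<oplus>\<^bsub>functional_module R M N\<^esub> f = \<zero>\<^bsub>functional_module R M N\<^esub>"
      using f by (auto simp: mem_dual R.l_neg intro!: restrict_ext)
    ultimately show "\<exists>g\<in>carrier (functional_module R M N).
        g \<oplus>\<^bsub>functional_module R M N\<^esub> f = \<zero>\<^bsub>functional_module R M N\<^esub>" by blast
    show "\<zero>\<^bsub>functional_module R M N\<^esub> \<oplus>\<^bsub>functional_module R M N\<^esub> f = f"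
      using f by (auto simp: mem_dual fun_eq_iff extensional_def)
  qed (auto simp: mem_dual closed R.a_ac R.r_distr intro!: restrict_ext)
qed (auto simp: mem_dual submodule_zero[OF N] submoduleE(4,5)[OF N] R.a_ac R.is_cring R.l_distr R.r_distr R.m_ac fun_eq_iff extensional_def)

context commutative_frobenius
begin

lemma functional_pairing:
  assumes "module K M" and N: "submodule N K M"
  shows "frobenius_pairing K M (functional_module K M N) N (\<lambda>x f. f x)"
proof -
  interpret M: module K M by fact
  show ?thesis
    by (intro frobenius_pairing.intro frobenius_pairing_axioms.intro commutative_frobenius_axioms
        M.functional_module_module N assms(1))
      (auto simp: mem_dual)
qed

text \<open>In the evaluation pairing of N with its dual, the orthogonal of 0 is the whole dual and
  that of N is 0.\<close>

lemma functional_module_length_le: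
  assumes "module K M" and N: "submodule N K M"
  shows "module_length K (functional_module K M N) {\<zero>\<^bsub>functional_module K M N\<^esub>} (dual K (M\<lparr>carrier := N\<rparr>))
      \<le> module_length K M {\<zero>\<^bsub>M\<^esub>} N"
proof -
  interpret M: module K M by fact
  interpret frobenius_pairing K M "functional_module K M N" N "\<lambda>x f. f x"
    using assms by (rule functional_pairing)
  have "perp N = {\<zero>\<^bsub>functional_module K M N\<^esub>}"
    using P.M.zero_closed
    by (auto simp: perp_def mem_dual fun_eq_iff extensional_def)
  then show ?thesis
    using module_length_perp_le[OF M.submodule_singleton_zero N] perp_zero M.submodule_zero[OF N]
    by simp
qed

section \<open>Self-injectivity of the ring\<close>

lemma multiplication_pairing:
  "frobenius_pairing K (left_regular K) (left_regular K) (carrier K) (\<otimes>)"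
  by (intro frobenius_pairing.intro frobenius_pairing_axioms.intro commutative_frobenius_axioms
      left_regular_module)
    (use regular.carrier_is_submodule in \<open>simp_all add: l_distr r_distr m_assoc m_lcomm\<close>)

text \<open>For the multiplication pairing of \<open>K\<close> with itself orthogonals are
  annihilators; the ends are ann 0 = K and ann K = 0, the latter because 1 is in
  \<open>K\<close>.\<close>

lemma annihilator_lengths:
  assumes I: "submodule I K (left_regular K)"
  shows "submodule (annihilator I) K (left_regular K)"
    and "ideal_length {\<zero>} (annihilator I) \<le> ideal_length I (carrier K)"
    and "ideal_length (annihilator I) (carrier K) \<le> ideal_length {\<zero>} I"
proof -
  interpret m: frobenius_pairing K "left_regular K" "left_regular K" "carrier K" "(\<otimes>)"
    by (rule multiplication_pairing)
  have IK: "I \<subseteq> carrier K" using regular.submoduleE(1)[OF I] by simp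
  have perp: "m.perp N = annihilator N" for N by (simp add: m.perp_def annihilator_def)
  have 0: "annihilator {\<zero>} = carrier K" by (auto simp: annihilator_def)
  have 1: "annihilator (carrier K) = {\<zero>}"
    by (auto simp: annihilator_def) (metis l_one one_closed)
  show "submodule (annihilator I) K (left_regular K)"
    using m.perp_submodule[OF IK] by (simp add: perp)
  show "ideal_length {\<zero>} (annihilator I) \<le> ideal_length I (carrier K)"
    using m.module_length_perp_le[OF I _ IK] regular.carrier_is_submodule by (simp add: perp 1)
  show "ideal_length (annihilator I) (carrier K) \<le> ideal_length {\<zero>} I"
    using m.module_length_perp_le[OF regular.submodule_singleton_zero I] IK regular.submodule_zero[OF I]
    by (simp add: perp 0)
qed

lemma ideal_length_split:
  assumes I: "submodule I K (left_regular K)"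
  obtains i j where "ideal_length {\<zero>} I = enat i" "ideal_length I (carrier K) = enat j"
    "ideal_length {\<zero>} (carrier K) = enat (i + j)"
proof -
  have "ideal_length {\<zero>} (carrier K) = ideal_length {\<zero>} I + ideal_length I (carrier K)"
    using regular.module_length_add[OF regular.submodule_singleton_zero I regular.carrier_is_submodule]
      regular.submodule_zero[OF I] regular.submoduleE(1)[OF I] by simp
  then show thesis
    using that finite_length
    by (cases "ideal_length {\<zero>} I"; cases "ideal_length I (carrier K)") auto
qed

text \<open>Both inequalities between I and ann I add up to l(K), which is finite, so neither can be
  strict.\<close>

lemma annihilator_length_eq:
  assumes I: "submodule I K (left_regular K)"
  shows "ideal_length I (carrier K) = ideal_length {\<zero>} (annihilator I)"
proof -
  obtain i j where ij: "ideal_length {\<zero>} I = enat i" "ideal_length I (carrier K) = enat j"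
    "ideal_length {\<zero>} (carrier K) = enat (i + j)"
    using ideal_length_split[OF I] by blast
  obtain k l where "ideal_length {\<zero>} (annihilator I) = enat k"
    "ideal_length (annihilator I) (carrier K) = enat l"
    "ideal_length {\<zero>} (carrier K) = enat (k + l)"
    using ideal_length_split[OF annihilator_lengths(1)[OF I]] by blast
  then show ?thesis using ij annihilator_lengths(2,3)[OF I] by simp
qed

text \<open>The condition of Baer's criterion. The map c -> (a -> a c) from \<open>K\<close> to the
  dual of I has kernel ann I, so its image has length at least l(K/ann I) = l(I), while the whole
  dual has length at most l(I).\<close>

lemma ideal_functional_is_multiplication:
  assumes I: "submodule I K (left_regular K)" and f: "f \<in> dual K ((left_regular K)\<lparr>carrier := I\<rparr>)"
  shows "\<exists>c\<in>carrier K. \<forall>a\<in>I. f a = a \<otimes> c"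
proof -
  let ?P = "functional_module K (left_regular K) I"
  let ?D = "dual K ((left_regular K)\<lparr>carrier := I\<rparr>)"
  let ?mu = "\<lambda>c. \<lambda>a\<in>I. a \<otimes> c"
  have car: "a \<in> carrier K" if "a \<in> I" for a using regular.submodule_carrier[OF I] that by simp
  note clI = regular.submoduleE(4,5)[OF I, simplified]
  have P: "module K ?P" by (rule regular.functional_module_module[OF I])
  interpret mu: partial_linear_map K "left_regular K" ?P "carrier K" ?mu
    by (intro partial_linear_map.intro partial_linear_map_axioms.intro left_regular_module P)
      (use regular.carrier_is_submodule in
        \<open>auto simp: mem_dual car clI l_distr r_distr m_assoc m_lcomm fun_eq_iff restrict_def extensional_def\<close>)
  have ker: "{c \<in> carrier K. ?mu c = \<zero>\<^bsub>?P\<^esub>} = annihilator I"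
    by (auto simp: annihilator_def fun_eq_iff restrict_def)
  have le1: "ideal_length (annihilator I) (carrier K) \<le> module_length K ?P {\<zero>\<^bsub>?P\<^esub>} (?mu ` carrier K)"
    using mu.module_length_image unfolding ker by simp
  have le2: "module_length K ?P {\<zero>\<^bsub>?P\<^esub>} ?D \<le> ideal_length {\<zero>} I"
    using functional_module_length_le[OF left_regular_module I] by simp
  have sub: "submodule (?mu ` carrier K) K ?P"
    using mu.image_submodule[OF mu.domain] by simp
  have subD: "?mu ` carrier K \<subseteq> ?D" using mu.map_closed by auto
  obtain i j where ij: "ideal_length {\<zero>} I = enat i" "ideal_length I (carrier K) = enat j"
    "ideal_length {\<zero>} (carrier K) = enat (i + j)"
    using ideal_length_split[OF I] by blast
  obtain k l where kl: "ideal_length {\<zero>} (annihilator I) = enat k"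
    "ideal_length (annihilator I) (carrier K) = enat l"
    "ideal_length {\<zero>} (carrier K) = enat (k + l)"
    using ideal_length_split[OF annihilator_lengths(1)[OF I]] by blast
  have "i = l" using ij kl annihilator_length_eq[OF I] by simp
  have "?mu ` carrier K = ?D"
  proof (rule ccontr)
    assume "?mu ` carrier K \<noteq> ?D"
    then have ss: "?mu ` carrier K \<subset> ?D" using subD by blast
    have "module_length K ?P {\<zero>\<^bsub>?P\<^esub>} (?mu ` carrier K) \<le> module_length K ?P {\<zero>\<^bsub>?P\<^esub>} ?D"
      using subD by (rule module_length_mono[OF order_refl])
    then have "module_length K ?P {\<zero>\<^bsub>?P\<^esub>} (?mu ` carrier K) \<le> enat i"
      using le2 ij by (auto intro: order_trans)
    then have "module_length K ?P {\<zero>\<^bsub>?P\<^esub>} (?mu ` carrier K) \<noteq> \<infinity>"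
      by (metis enat_ile enat.distinct(1))
    then have "module_length K ?P {\<zero>\<^bsub>?P\<^esub>} (?mu ` carrier K) < module_length K ?P {\<zero>\<^bsub>?P\<^esub>} ?D"
      using mu.P.module_length_strict_mono[OF mu.P.submodule_singleton_zero sub _ _ ss]
        mu.P.carrier_is_submodule mu.P.submodule_zero[OF sub] by simp
    then have "module_length K ?P {\<zero>\<^bsub>?P\<^esub>} (?mu ` carrier K) < enat i"
      using le2 ij by simp
    then show False using le1 kl \<open>i = l\<close> by simp
  qed
  then obtain c where "c \<in> carrier K" "f = ?mu c" using f by blast
  then show ?thesis by auto
qed

end

section \<open>Finitely generated modules and their duals\<close>

lemma (in module) finsum_mem_submodule:
  assumes N: "submodule N R M" and "finite S" and "\<And>x. x \<in> S \<Longrightarrow> g x \<in> N"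
  shows "finsum M g S \<in> N"
  using assms(2,3)
proof (induction S rule: finite_induct)
  case empty
  then show ?case using submodule_zero[OF N] by simp
next
  case (insert x S)
  then have "finsum M g (insert x S) = g x \<oplus>\<^bsub>M\<^esub> finsum M g S"
    using submodule_carrier[OF N] by (intro M.finsum_insert) auto
  then show ?case using insert submoduleE(5)[OF N] by simp
qed

context commutative_frobenius
begin

text \<open>The only candidate sends n + a s to f n + a c. It is well defined once f (a s) = a c
  holds for all a in the ideal (N : s), which is the last assumption.\<close>

lemma functional_extension:
  assumes "module K M" and N: "submodule N K M" and s: "s \<in> carrier M"
    and f: "f \<in> dual K (M\<lparr>carrier := N\<rparr>)" and c: "c \<in> carrier K"
    and comp: "\<And>a. a \<in> carrier K \<Longrightarrow> a \<odot>\<^bsub>M\<^esub> s \<in> N \<Longrightarrow> f (a \<odot>\<^bsub>M\<^esub> s) = a \<otimes> c"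
  shows "\<exists>g\<in>dual K (M\<lparr>carrier := N <+>\<^bsub>M\<^esub> cyclic_submodule K M s\<rparr>). g s = c \<and> (\<forall>x\<in>N. g x = f x)"
proof -
  interpret M: module K M by fact
  let ?N' = "N <+>\<^bsub>M\<^esub> cyclic_submodule K M s"
  have N': "submodule ?N' K M" by (intro M.submodule_set_add N M.submodule_cyclic s)
  have car: "n \<in> carrier M" if "n \<in> N" for n using M.submodule_carrier[OF N that] .
  have fK: "f n \<in> carrier K" if "n \<in> N" for n using f that by (simp add: mem_dual)
  have fadd: "f (x \<oplus>\<^bsub>M\<^esub> y) = f x \<oplus> f y" if "x \<in> N" "y \<in> N" for x y
    using f that by (simp add: mem_dual)
  have fsm: "f (a \<odot>\<^bsub>M\<^esub> x) = a \<otimes> f x" if "a \<in> carrier K" "x \<in> N" for a x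
    using f that by (simp add: mem_dual)
  have decomp: "\<exists>n\<in>N. \<exists>a\<in>carrier K. x = n \<oplus>\<^bsub>M\<^esub> a \<odot>\<^bsub>M\<^esub> s" if "x \<in> ?N'" for x
  proof -
    obtain n d where "n \<in> N" "d \<in> cyclic_submodule K M s" "x = n \<oplus>\<^bsub>M\<^esub> d"
      using \<open>x \<in> ?N'\<close> unfolding M.mem_set_add by blast
    then show ?thesis unfolding M.mem_cyclic_submodule by blast
  qed
  have wd: "f n \<oplus> a \<otimes> c = f n' \<oplus> a' \<otimes> c"
    if n: "n \<in> N" "n' \<in> N" and a: "a \<in> carrier K" "a' \<in> carrier K"
      and eq: "n \<oplus>\<^bsub>M\<^esub> a \<odot>\<^bsub>M\<^esub> s = n' \<oplus>\<^bsub>M\<^esub> a' \<odot>\<^bsub>M\<^esub> s" for n n' a a'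
  proof -
    have e: "n \<oplus>\<^bsub>M\<^esub> (a \<ominus> a') \<odot>\<^bsub>M\<^esub> s = n'"
    proof -
      have "n \<oplus>\<^bsub>M\<^esub> (a \<ominus> a') \<odot>\<^bsub>M\<^esub> s = (n \<oplus>\<^bsub>M\<^esub> a \<odot>\<^bsub>M\<^esub> s) \<ominus>\<^bsub>M\<^esub> a' \<odot>\<^bsub>M\<^esub> s"
        using n a s car by (simp add: a_minus_def M.smult_l_distr M.smult_l_minus M.M.a_assoc)
      also have "\<dots> = n'"
        unfolding eq using n a s car by (simp add: a_minus_def M.M.a_assoc M.M.r_neg)
      finally show ?thesis .
    qed
    have "(a \<ominus> a') \<odot>\<^bsub>M\<^esub> s \<in> N"
      by (rule M.submodule_cancel_left[OF N n(1)]) (use a s n e in auto)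
    then have "f n' = f n \<oplus> (a \<ominus> a') \<otimes> c"
      using fadd[OF n(1), of "(a \<ominus> a') \<odot>\<^bsub>M\<^esub> s"] comp[of "a \<ominus> a'"] a e by simp
    then show ?thesis using fK[OF n(1)] a c by algebra
  qed
  define g where "g = (\<lambda>x\<in>?N'. THE v. \<exists>n\<in>N. \<exists>a\<in>carrier K. x = n \<oplus>\<^bsub>M\<^esub> a \<odot>\<^bsub>M\<^esub> s \<and> v = f n \<oplus> a \<otimes> c)"
  have mem: "n \<oplus>\<^bsub>M\<^esub> a \<odot>\<^bsub>M\<^esub> s \<in> ?N'" if "n \<in> N" "a \<in> carrier K" for n a
    using that unfolding M.mem_set_add M.mem_cyclic_submodule cyclic_submodule_def by blast
  have g: "g (n \<oplus>\<^bsub>M\<^esub> a \<odot>\<^bsub>M\<^esub> s) = f n \<oplus> a \<otimes> c" if na: "n \<in> N" "a \<in> carrier K" for n a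
    unfolding g_def restrict_apply'[OF mem[OF na]]
  proof (rule the_equality)
    show "v = f n \<oplus> a \<otimes> c"
      if "\<exists>n'\<in>N. \<exists>a'\<in>carrier K. n \<oplus>\<^bsub>M\<^esub> a \<odot>\<^bsub>M\<^esub> s = n' \<oplus>\<^bsub>M\<^esub> a' \<odot>\<^bsub>M\<^esub> s \<and> v = f n' \<oplus> a' \<otimes> c" for v
      using that wd na by metis
  qed (use na in blast)
  have gN: "g x = f x" if "x \<in> N" for x
    using g[of x \<zero>] that s car[OF that] fK[OF that] c by simp
  have gs: "g s = c"
  proof -
    have "f \<zero>\<^bsub>M\<^esub> = \<zero>" using comp[of \<zero>] s c M.submodule_zero[OF N] by simp
    then show ?thesis using g[of "\<zero>\<^bsub>M\<^esub>" \<one>] s c M.submodule_zero[OF N] by simp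
  qed
  have "g \<in> dual K (M\<lparr>carrier := ?N'\<rparr>)"
    unfolding mem_dual
  proof (intro conjI ballI)
    show "g \<in> extensional ?N'" by (simp add: g_def)
    fix x assume "x \<in> ?N'"
    then obtain n a where na: "n \<in> N" "a \<in> carrier K" "x = n \<oplus>\<^bsub>M\<^esub> a \<odot>\<^bsub>M\<^esub> s" using decomp by blast
    show "g x \<in> carrier K" using na g fK c by simp
    {
      fix y assume "y \<in> ?N'"
      then obtain n' a' where na': "n' \<in> N" "a' \<in> carrier K" "y = n' \<oplus>\<^bsub>M\<^esub> a' \<odot>\<^bsub>M\<^esub> s"
        using decomp by blast
      have "x \<oplus>\<^bsub>M\<^esub> y = (n \<oplus>\<^bsub>M\<^esub> n') \<oplus>\<^bsub>M\<^esub> (a \<oplus> a') \<odot>\<^bsub>M\<^esub> s"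
        using na na' s car by (simp add: M.smult_l_distr M.M.a_ac)
      then have "g (x \<oplus>\<^bsub>M\<^esub> y) = (f n \<oplus> f n') \<oplus> (a \<oplus> a') \<otimes> c"
        using g[of "n \<oplus>\<^bsub>M\<^esub> n'" "a \<oplus> a'"] na na' M.submoduleE(5)[OF N] fadd by simp
      also have "\<dots> = g x \<oplus> g y"
        using na na' g fK[OF na(1)] fK[OF na'(1)] c by (simp add: l_distr a_ac)
      finally show "g (x \<oplus>\<^bsub>M\<^esub> y) = g x \<oplus> g y" .
    next
      fix b assume b: "b \<in> carrier K"
      have "b \<odot>\<^bsub>M\<^esub> x = b \<odot>\<^bsub>M\<^esub> n \<oplus>\<^bsub>M\<^esub> (b \<otimes> a) \<odot>\<^bsub>M\<^esub> s"
        using na b s car by (simp add: M.smult_r_distr M.smult_assoc1)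
      then show "g (b \<odot>\<^bsub>M\<^esub> x) = b \<otimes> g x"
        using g[of "b \<odot>\<^bsub>M\<^esub> n" "b \<otimes> a"] na b M.submodule_smult[OF N] fsm g fK c
        by (simp add: r_distr m_assoc)
    }
  qed
  then show ?thesis using gs gN by blast
qed

abbreviation dual_length :: "('a, 'b, 'n) module_scheme \<Rightarrow> 'b set \<Rightarrow> enat" where
  "dual_length M N \<equiv> module_length K (functional_module K M N)
     {\<zero>\<^bsub>functional_module K M N\<^esub>} (dual K (M\<lparr>carrier := N\<rparr>))"

text \<open>The map S -> (S : s) is strictly monotone between N and N + Ks: an element of T outside
  S has the form n + a s, and this a lies in (T : s) but not in (S : s).\<close>

lemma module_length_cyclic_extension:
  assumes "module K M" and N: "submodule N K M" and s: "s \<in> carrier M"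
  shows "module_length K M N (N <+>\<^bsub>M\<^esub> cyclic_submodule K M s)
     \<le> ideal_length {a \<in> carrier K. a \<odot>\<^bsub>M\<^esub> s \<in> N} (carrier K)"
proof -
  interpret M: module K M by fact
  show ?thesis
  proof (rule module_length_image_le[where f = "\<lambda>S. {a \<in> carrier K. a \<odot>\<^bsub>M\<^esub> s \<in> S}"])
    fix S assume S: "submodule S K M" "N \<subseteq> S"
    have "submodule {a \<in> carrier K. a \<odot>\<^bsub>M\<^esub> s \<in> S} K (left_regular K)"
      by (rule M.transporter_submodule[OF S(1) s])
    then show "submodule {a \<in> carrier K. a \<odot>\<^bsub>M\<^esub> s \<in> S} K (left_regular K) \<and>
        {a \<in> carrier K. a \<odot>\<^bsub>M\<^esub> s \<in> N} \<subseteq> {a \<in> carrier K. a \<odot>\<^bsub>M\<^esub> s \<in> S} \<and>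
        {a \<in> carrier K. a \<odot>\<^bsub>M\<^esub> s \<in> S} \<subseteq> carrier K"
      using S by auto
  next
    fix S T assume S: "submodule S K M" and T: "submodule T K M" and NS: "N \<subseteq> S"
      and TN: "T \<subseteq> N <+>\<^bsub>M\<^esub> cyclic_submodule K M s" and ST: "S \<subset> T"
    obtain t where t: "t \<in> T" "t \<notin> S" using ST by blast
    have "t \<in> N <+>\<^bsub>M\<^esub> cyclic_submodule K M s" using t TN by blast
    then obtain n d where nd: "n \<in> N" "d \<in> cyclic_submodule K M s" "t = n \<oplus>\<^bsub>M\<^esub> d"
      unfolding M.mem_set_add by blast
    then obtain a where a: "a \<in> carrier K" "d = a \<odot>\<^bsub>M\<^esub> s" unfolding M.mem_cyclic_submodule by blast
    have "d \<in> T" using M.submodule_cancel_left[OF T, of n d] nd a t NS ST s by auto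
    moreover have "d \<notin> S" using M.submoduleE(5)[OF S, of n d] nd t NS by auto
    ultimately show "{a \<in> carrier K. a \<odot>\<^bsub>M\<^esub> s \<in> S} \<subset> {a \<in> carrier K. a \<odot>\<^bsub>M\<^esub> s \<in> T}"
      using a ST by blast
  qed
qed

text \<open>Restriction maps the functionals on N + Ks onto those on N, and evaluation at s maps its
  kernel Z onto at least ann (N : s), which has the length of K/(N : s). Both surjectivity claims
  rest on \<open>functional_extension\<close>, and additivity combines the two lower bounds.\<close>

lemma dual_length_cyclic_extension:
  assumes "module K M" and N: "submodule N K M" and s: "s \<in> carrier M"
  shows "ideal_length {a \<in> carrier K. a \<odot>\<^bsub>M\<^esub> s \<in> N} (carrier K) + dual_length M N
     \<le> dual_length M (N <+>\<^bsub>M\<^esub> cyclic_submodule K M s)"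
proof -
  interpret M: module K M by fact
  let ?I = "{a \<in> carrier K. a \<odot>\<^bsub>M\<^esub> s \<in> N}"
  let ?N' = "N <+>\<^bsub>M\<^esub> cyclic_submodule K M s"
  let ?P = "functional_module K M ?N'" and ?Q = "functional_module K M N"
  let ?D = "dual K (M\<lparr>carrier := ?N'\<rparr>)"
  have C: "submodule (cyclic_submodule K M s) K M" by (rule M.submodule_cyclic[OF s])
  have N': "submodule ?N' K M" by (rule M.submodule_set_add[OF N C])
  note up = M.set_add_upper[OF N C]
  have sN': "s \<in> ?N'" using up(2) M.generator_mem_cyclic[OF s] by blast
  have P: "module K ?P" and Q: "module K ?Q"
    using M.functional_module_module N N' by auto
  have I: "submodule ?I K (left_regular K)"
    by (rule M.transporter_submodule[OF N s])
  have NN': "x \<in> ?N'" if "x \<in> N" for x using up(1) that by blast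
  interpret res: partial_linear_map K ?P ?Q ?D "\<lambda>g. restrict g N"
  proof (intro partial_linear_map.intro partial_linear_map_axioms.intro P Q)
    show "submodule ?D K ?P" using module.carrier_is_submodule[OF P] by simp
  qed (auto simp: mem_dual NN' M.submoduleE(4,5)[OF N] fun_eq_iff restrict_def extensional_def)
  have res_surj: "dual K (M\<lparr>carrier := N\<rparr>) \<subseteq> (\<lambda>g. restrict g N) ` ?D"
  proof
    fix f assume f: "f \<in> dual K (M\<lparr>carrier := N\<rparr>)"
    \<comment> \<open>A functional on the ideal (N : s), hence multiplication by some c; this c is
      the value at s that extends f.\<close>
    let ?h = "\<lambda>a\<in>?I. f (a \<odot>\<^bsub>M\<^esub> s)"
    have "?h \<in> dual K ((left_regular K)\<lparr>carrier := ?I\<rparr>)"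
      unfolding mem_dual
      using f s regular.submoduleE(4,5)[OF I, simplified]
      by (auto simp: mem_dual M.smult_l_distr M.smult_assoc1)
    then obtain c where c: "c \<in> carrier K" "\<And>a. a \<in> ?I \<Longrightarrow> ?h a = a \<otimes> c"
      using ideal_functional_is_multiplication[OF I] by blast
    then obtain g where g: "g \<in> ?D" "\<And>x. x \<in> N \<Longrightarrow> g x = f x"
      using functional_extension[OF assms(1) N s f c(1)] by auto
    moreover have "f \<in> extensional N" using f by (simp add: mem_dual)
    ultimately have "f = restrict g N" by (auto simp: fun_eq_iff restrict_def extensional_def)
    then show "f \<in> (\<lambda>g. restrict g N) ` ?D" using g(1) by blast
  qed
  define Z where "Z = {g \<in> ?D. restrict g N = \<zero>\<^bsub>?Q\<^esub>}"
  have Z: "submodule Z K ?P"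
    using res.preimage_submodule[OF res.P.submodule_singleton_zero] by (simp add: Z_def)
  have "{g \<in> ?D. restrict g N \<in> dual K (M\<lparr>carrier := N\<rparr>)} = ?D"
    using res.map_closed by auto
  then have le1: "dual_length M N \<le> module_length K ?P Z ?D"
    using res.module_length_preimage[OF res_surj, of "{\<zero>\<^bsub>?Q\<^esub>}"] by (simp add: Z_def)
  interpret ev: partial_linear_map K ?P "left_regular K" Z "\<lambda>g. g s"
    by (intro partial_linear_map.intro partial_linear_map_axioms.intro P left_regular_module Z)
      (auto simp: Z_def mem_dual sN')
  have ev_surj: "annihilator ?I \<subseteq> (\<lambda>g. g s) ` Z"
  proof
    fix c assume c: "c \<in> annihilator ?I"
    have "\<exists>g\<in>?D. g s = c \<and> (\<forall>x\<in>N. g x = \<zero>\<^bsub>?Q\<^esub> x)"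
    proof (rule functional_extension[OF assms(1) N s])
      show "\<zero>\<^bsub>?Q\<^esub> \<in> dual K (M\<lparr>carrier := N\<rparr>)" using res.P.M.zero_closed by simp
    qed (use c in \<open>auto simp: annihilator_def\<close>)
    then obtain g where "g \<in> ?D" "g s = c" "restrict g N = \<zero>\<^bsub>?Q\<^esub>"
      by (auto simp: fun_eq_iff restrict_def)
    then show "c \<in> (\<lambda>g. g s) ` Z" by (auto simp: Z_def)
  qed
  have "ideal_length ?I (carrier K) = ideal_length {\<zero>} (annihilator ?I)"
    by (rule annihilator_length_eq[OF I])
  also have "\<dots> \<le> module_length K ?P {g \<in> Z. g s \<in> {\<zero>}} {g \<in> Z. g s \<in> annihilator ?I}"
    by (rule ev.module_length_preimage[OF ev_surj])
  also have "\<dots> \<le> module_length K ?P {\<zero>\<^bsub>?P\<^esub>} Z"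
    using res.M.submodule_zero[OF Z] sN' by (intro module_length_mono) auto
  finally have le2: "ideal_length ?I (carrier K) \<le> module_length K ?P {\<zero>\<^bsub>?P\<^esub>} Z" .
  have "dual_length M ?N' = module_length K ?P {\<zero>\<^bsub>?P\<^esub>} Z + module_length K ?P Z ?D"
    using res.M.module_length_add[OF res.M.submodule_singleton_zero Z res.domain] res.M.submodule_zero[OF Z]
    by (auto simp: Z_def)
  then show ?thesis using add_mono[OF le2 le1] by simp
qed

text \<open>When a generator s is added, l(N) grows by at most l(K/(N : s)) and the length of the
  dual by at least as much. So l(N) never exceeds the length of the dual, and for N = M the general
  upper bound for duals gives equality.\<close>

lemma dual_length_eq:
  assumes M: "module K M" and fg: "finitely_generated_module K M"
  shows "dual_length M (carrier M) = module_length K M {\<zero>\<^bsub>M\<^esub>} (carrier M)"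
    and "module_length K M {\<zero>\<^bsub>M\<^esub>} (carrier M) \<noteq> \<infinity>"
proof -
  interpret M: module K M by fact
  \<comment> \<open>The span of S is left unnamed: some submodule that contains S and obeys the
    bounds is enough, since for a generating set S it must be all of \<open>M\<close>.\<close>
  have span: "\<exists>N. submodule N K M \<and> S \<subseteq> N \<and> module_length K M {\<zero>\<^bsub>M\<^esub>} N \<le> dual_length M N
      \<and> module_length K M {\<zero>\<^bsub>M\<^esub>} N \<noteq> \<infinity>" if "finite S" "S \<subseteq> carrier M" for S
    using that
  proof (induction S rule: finite_induct)
    case empty
    then show ?case
      using M.submodule_singleton_zero by (intro exI[of _ "{\<zero>\<^bsub>M\<^esub>}"]) auto
  next
    case (insert s S)
    then have "S \<subseteq> carrier M" by simp
    then obtain N where N: "submodule N K M" "S \<subseteq> N"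
      "module_length K M {\<zero>\<^bsub>M\<^esub>} N \<le> dual_length M N" "module_length K M {\<zero>\<^bsub>M\<^esub>} N \<noteq> \<infinity>"
      using insert.IH by blast
    have s: "s \<in> carrier M" using insert by simp
    let ?C = "cyclic_submodule K M s" and ?I = "{a \<in> carrier K. a \<odot>\<^bsub>M\<^esub> s \<in> N}"
    let ?N' = "N <+>\<^bsub>M\<^esub> ?C"
    have C: "submodule ?C K M" by (rule M.submodule_cyclic[OF s])
    have N': "submodule ?N' K M" by (rule M.submodule_set_add[OF N(1) C])
    note up = M.set_add_upper[OF N(1) C]
    have "s \<in> ?N'" using up(2) M.generator_mem_cyclic[OF s] by blast
    then have sub: "insert s S \<subseteq> ?N'" using up(1) N(2) by blast
    have le: "module_length K M {\<zero>\<^bsub>M\<^esub>} ?N'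
        \<le> module_length K M {\<zero>\<^bsub>M\<^esub>} N + ideal_length ?I (carrier K)"
    proof -
      have "module_length K M {\<zero>\<^bsub>M\<^esub>} ?N' = module_length K M {\<zero>\<^bsub>M\<^esub>} N + module_length K M N ?N'"
        using M.submodule_zero[OF N(1)]
        by (intro M.module_length_add M.submodule_singleton_zero N(1) N' up(1)) simp
      then show ?thesis
        using module_length_cyclic_extension[OF M N(1) s] by (simp add: add_left_mono)
    qed
    have "ideal_length ?I (carrier K) \<le> ideal_length {\<zero>} (carrier K)"
      using s M.submodule_zero[OF N(1)] by (intro module_length_mono) auto
    then have "ideal_length ?I (carrier K) \<noteq> \<infinity>"
      using finite_length by (cases "ideal_length ?I (carrier K)") simp_all
    then have fin: "module_length K M {\<zero>\<^bsub>M\<^esub>} ?N' \<noteq> \<infinity>"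
      using le N(4)
      by (cases "module_length K M {\<zero>\<^bsub>M\<^esub>} N"; cases "ideal_length ?I (carrier K)";
          cases "module_length K M {\<zero>\<^bsub>M\<^esub>} ?N'") simp_all
    have "module_length K M {\<zero>\<^bsub>M\<^esub>} ?N' \<le> dual_length M N + ideal_length ?I (carrier K)"
      using le N(3) by (meson add_right_mono order_trans)
    also have "\<dots> \<le> dual_length M ?N'"
      using dual_length_cyclic_extension[OF M N(1) s] by (simp add: add.commute)
    finally show ?case using N' sub fin by blast
  qed
  obtain S where S: "finite S" "S \<subseteq> carrier M"
    "\<And>x. x \<in> carrier M \<Longrightarrow> \<exists>c\<in>S \<rightarrow> carrier K. x = (\<Oplus>\<^bsub>M\<^esub>s\<in>S. c s \<odot>\<^bsub>M\<^esub> s)"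
    using fg unfolding finitely_generated_module_def by blast
  obtain N where N: "submodule N K M" "S \<subseteq> N"
    "module_length K M {\<zero>\<^bsub>M\<^esub>} N \<le> dual_length M N" "module_length K M {\<zero>\<^bsub>M\<^esub>} N \<noteq> \<infinity>"
    using span[OF S(1,2)] by blast
  have "x \<in> N" if x: "x \<in> carrier M" for x
  proof -
    obtain c where c: "c \<in> S \<rightarrow> carrier K" "x = (\<Oplus>\<^bsub>M\<^esub>s\<in>S. c s \<odot>\<^bsub>M\<^esub> s)" using S(3)[OF x] by blast
    have "c s \<odot>\<^bsub>M\<^esub> s \<in> N" if "s \<in> S" for s
      using that c(1) N(2) M.submodule_smult[OF N(1)] by blast
    then show ?thesis using c(2) M.finsum_mem_submodule[OF N(1) S(1)] by simp
  qed
  then have eq: "N = carrier M" using M.submoduleE(1)[OF N(1)] by blast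
  show "module_length K M {\<zero>\<^bsub>M\<^esub>} (carrier M) \<noteq> \<infinity>" using N(4) eq by simp
  show "dual_length M (carrier M) = module_length K M {\<zero>\<^bsub>M\<^esub>} (carrier M)"
    using N(3) functional_module_length_le[OF M N(1)] eq by (simp add: antisym)
qed

end

section \<open>Linear maps from a module to its dual\<close>

lemma (in partial_linear_map) inj_on_iff_kernel:
  "inj_on f N \<longleftrightarrow> {x \<in> N. f x = \<zero>\<^bsub>P\<^esub>} = {\<zero>\<^bsub>M\<^esub>}"
proof
  assume inj: "inj_on f N"
  have "x = \<zero>\<^bsub>M\<^esub>" if "x \<in> N" "f x = \<zero>\<^bsub>P\<^esub>" for x
    using inj_onD[OF inj, of x "\<zero>\<^bsub>M\<^esub>"] that M.submodule_zero[OF domain] by simp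
  then show "{x \<in> N. f x = \<zero>\<^bsub>P\<^esub>} = {\<zero>\<^bsub>M\<^esub>}"
    using M.submodule_zero[OF domain] map_zero by blast
next
  assume ker: "{x \<in> N. f x = \<zero>\<^bsub>P\<^esub>} = {\<zero>\<^bsub>M\<^esub>}"
  show "inj_on f N"
  proof (rule inj_onI)
    fix x y assume xy: "x \<in> N" "y \<in> N" "f x = f y"
    have car: "x \<in> carrier M" "y \<in> carrier M" using xy M.submodule_carrier[OF domain] by auto
    have my: "\<ominus>\<^bsub>M\<^esub> y \<in> N" using M.submoduleE(3)[OF domain xy(2)] .
    have "f (x \<oplus>\<^bsub>M\<^esub> \<ominus>\<^bsub>M\<^esub> y) = \<zero>\<^bsub>P\<^esub>"
      using xy my map_closed[OF xy(2)] by (simp add: map_add map_minus P.M.r_neg)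
    then have "x \<oplus>\<^bsub>M\<^esub> \<ominus>\<^bsub>M\<^esub> y = \<zero>\<^bsub>M\<^esub>"
      using ker xy(1) my M.submoduleE(5)[OF domain] by blast
    then show "x = y" using car M.M.minus_equality[of x "\<ominus>\<^bsub>M\<^esub> y"] by simp
  qed
qed

lemma (in module) submodule_eq_zero_if_colength:
  assumes T: "submodule T R M" and fin: "module_length R M {\<zero>\<^bsub>M\<^esub>} (carrier M) \<noteq> \<infinity>"
    and le: "module_length R M {\<zero>\<^bsub>M\<^esub>} (carrier M) \<le> module_length R M T (carrier M)"
  shows "T = {\<zero>\<^bsub>M\<^esub>}"
proof (rule ccontr)
  assume "T \<noteq> {\<zero>\<^bsub>M\<^esub>}"
  then have "{\<zero>\<^bsub>M\<^esub>} \<subset> T" using submodule_zero[OF T] by auto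
  then have "1 \<le> module_length R M {\<zero>\<^bsub>M\<^esub>} T"
    by (intro module_length_pos submodule_singleton_zero T)
  moreover have "module_length R M {\<zero>\<^bsub>M\<^esub>} (carrier M)
      = module_length R M {\<zero>\<^bsub>M\<^esub>} T + module_length R M T (carrier M)"
    using submodule_zero[OF T] submoduleE(1)[OF T]
    by (intro module_length_add submodule_singleton_zero T carrier_is_submodule) auto
  ultimately show False
    using fin le
    by (cases "module_length R M {\<zero>\<^bsub>M\<^esub>} T"; cases "module_length R M T (carrier M)")
      (auto simp: one_enat_def)
qed

lemma dual_carrier [simp]: "dual K (M\<lparr>carrier := carrier M\<rparr>) = dual K M"
  by (simp add: dual_def module_homs_def)

lemma mem_dual_carrier:
  "f \<in> dual K M \<longleftrightarrow>
     f \<in> extensional (carrier M) \<and> (\<forall>x\<in>carrier M. f x \<in> carrier K) \<and>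
     (\<forall>x\<in>carrier M. \<forall>y\<in>carrier M. f (x \<oplus>\<^bsub>M\<^esub> y) = f x \<oplus>\<^bsub>K\<^esub> f y) \<and>
     (\<forall>a\<in>carrier K. \<forall>x\<in>carrier M. f (a \<odot>\<^bsub>M\<^esub> x) = a \<otimes>\<^bsub>K\<^esub> f x)"
  using mem_dual[where f = f and K = K and M = M and N = "carrier M"] by simp

context commutative_frobenius
begin

text \<open>Source and target have the same finite length: the image of an injective map exhausts
  the target, and a surjective map leaves no length for a kernel.\<close>

lemma dual_map_inj_iff_surj:
  assumes M: "module K M" and fg: "finitely_generated_module K M"
    and f: "partial_linear_map K M (functional_module K M (carrier M)) (carrier M) f"
  shows "inj_on f (carrier M) \<longleftrightarrow> f ` carrier M = dual K M"
proof -
  interpret f: partial_linear_map K M "functional_module K M (carrier M)" "carrier M" f by fact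
  let ?P = "functional_module K M (carrier M)"
  let ?l = "module_length K M {\<zero>\<^bsub>M\<^esub>} (carrier M)"
  note len = dual_length_eq[OF M fg, unfolded dual_carrier]
  let ?ker = "{x \<in> carrier M. f x = \<zero>\<^bsub>?P\<^esub>}"
  have sub: "f ` carrier M \<subseteq> dual K M" using f.map_closed by auto
  show ?thesis
  proof
    assume "inj_on f (carrier M)"
    then have ker: "?ker = {\<zero>\<^bsub>M\<^esub>}" using f.inj_on_iff_kernel by blast
    have le: "?l \<le> module_length K ?P {\<zero>\<^bsub>?P\<^esub>} (f ` carrier M)"
      using f.module_length_image unfolding ker .
    have le': "module_length K ?P {\<zero>\<^bsub>?P\<^esub>} (f ` carrier M) \<le> ?l"
      using module_length_mono[OF order_refl sub, of K ?P "{\<zero>\<^bsub>?P\<^esub>}"] len by simp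
    show "f ` carrier M = dual K M"
    proof (rule ccontr)
      assume "f ` carrier M \<noteq> dual K M"
      then have ss: "f ` carrier M \<subset> dual K M" using sub by blast
      have im: "submodule (f ` carrier M) K ?P" using f.image_submodule[OF f.domain] by simp
      have "module_length K ?P {\<zero>\<^bsub>?P\<^esub>} (f ` carrier M) < module_length K ?P {\<zero>\<^bsub>?P\<^esub>} (dual K M)"
      proof (rule f.P.module_length_strict_mono[OF f.P.submodule_singleton_zero im _ _ ss])
        show "submodule (dual K M) K ?P" using f.P.carrier_is_submodule by simp
        show "{\<zero>\<^bsub>?P\<^esub>} \<subseteq> f ` carrier M" using f.P.submodule_zero[OF im] by blast
        show "module_length K ?P {\<zero>\<^bsub>?P\<^esub>} (f ` carrier M) \<noteq> \<infinity>"
          using le' len(2) by (cases ?l) (auto simp del: functional_module_simps dest: enat_ile)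
      qed
      then show False using le len(1) by simp
    qed
  next
    assume surj: "f ` carrier M = dual K M"
    have ker: "submodule ?ker K M"
      using f.preimage_submodule[OF f.P.submodule_singleton_zero] by simp
    have "module_length K ?P {\<zero>\<^bsub>?P\<^esub>} (dual K M)
        \<le> module_length K M {x \<in> carrier M. f x \<in> {\<zero>\<^bsub>?P\<^esub>}} {x \<in> carrier M. f x \<in> dual K M}"
      using surj by (intro f.module_length_preimage) simp
    also have "{x \<in> carrier M. f x \<in> dual K M} = carrier M" using sub by blast
    finally have "?l \<le> module_length K M ?ker (carrier M)"
      by (simp only: len(1) singleton_iff)
    then have "?ker = {\<zero>\<^bsub>M\<^esub>}"
      using f.M.submodule_eq_zero_if_colength[OF ker len(2)] by blast
    then show "inj_on f (carrier M)" using f.inj_on_iff_kernel by blast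
  qed
qed

text \<open>The orthogonal of the common kernel T of all functionals is the whole dual, so the dual
  has length at most l(M/T). As its length is l(M), which is finite, T = 0.\<close>

lemma dual_separates:
  assumes M: "module K M" and fg: "finitely_generated_module K M"
    and x: "x \<in> carrier M" "\<And>f. f \<in> dual K M \<Longrightarrow> f x = \<zero>"
  shows "x = \<zero>\<^bsub>M\<^esub>"
proof -
  interpret M: module K M by fact
  let ?P = "functional_module K M (carrier M)"
  interpret p: frobenius_pairing K M ?P "carrier M" "\<lambda>x f. f x"
    by (rule functional_pairing[OF M M.carrier_is_submodule])
  note len = dual_length_eq[OF M fg, unfolded dual_carrier]
  define T where "T = {x \<in> carrier M. \<forall>f\<in>dual K M. f x = \<zero>}"
  have f0: "f \<zero>\<^bsub>M\<^esub> = \<zero>" if "f \<in> dual K M" for f using p.pair_zero_left[of f] that by simp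
  have T: "submodule T K M"
  proof (rule M.submoduleI)
    show "\<ominus>\<^bsub>M\<^esub> a \<in> T" if "a \<in> T" for a
    proof -
      have a: "a \<in> carrier M" using that by (simp add: T_def)
      have "f (\<ominus>\<^bsub>M\<^esub> a) = \<zero>" if f: "f \<in> dual K M" for f
      proof -
        have "f a = \<zero>" using \<open>a \<in> T\<close> f unfolding T_def by blast
        then show ?thesis
          using p.pair_smult_left[of "\<ominus> \<one>" a f] f a by (simp add: M.smult_l_minus)
      qed
      then show ?thesis using a by (simp add: T_def)
    qed
  qed (auto simp: T_def f0 mem_dual_carrier)
  have "p.perp T = dual K M" by (auto simp: p.perp_def T_def)
  moreover have "p.perp (carrier M) = {\<zero>\<^bsub>?P\<^esub>}"
    using p.P.M.zero_closed
    by (auto simp: p.perp_def mem_dual_carrier fun_eq_iff extensional_def)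
  ultimately have "module_length K M {\<zero>\<^bsub>M\<^esub>} (carrier M) \<le> module_length K M T (carrier M)"
    using p.module_length_perp_le[OF T M.carrier_is_submodule M.submoduleE(1)[OF T]] len(1) by simp
  then have "T = {\<zero>\<^bsub>M\<^esub>}" by (rule M.submodule_eq_zero_if_colength[OF T len(2)])
  moreover have "x \<in> T" using x by (simp add: T_def)
  ultimately show ?thesis by simp
qed

end

section \<open>Frobenius forms\<close>

locale finite_frobenius_algebra = commutative_frobenius K + R: ring_algebra K R
  for K :: "('k, 'm) ring_scheme" (structure) and R :: "('k, 'r, 'n) module_scheme" +
  assumes finitely_generated: "finitely_generated_module K R"
begin

text \<open>The map b -> e b of the bimodule of functionals. Curried, the same function is the form
  (b, x) -> e (b x), so one object serves as form, as slot map and as module homomorphism.\<close>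

definition right_orbit_map :: "('r \<Rightarrow> 'k) \<Rightarrow> 'r \<Rightarrow> 'r \<Rightarrow> 'k" where
  "right_orbit_map e = (\<lambda>b\<in>carrier R. \<lambda>x\<in>carrier R. e (b \<otimes>\<^bsub>R\<^esub> x))"

definition left_orbit_map :: "('r \<Rightarrow> 'k) \<Rightarrow> 'r \<Rightarrow> 'r \<Rightarrow> 'k" where
  "left_orbit_map e = (\<lambda>b\<in>carrier R. \<lambda>x\<in>carrier R. e (x \<otimes>\<^bsub>R\<^esub> b))"

lemma right_orbit_map_linear:
  assumes "e \<in> dual K R"
  shows "partial_linear_map K R (functional_module K R (carrier R)) (carrier R) (right_orbit_map e)"
  by (intro partial_linear_map.intro partial_linear_map_axioms.intro R.module_axioms
      R.functional_module_module R.carrier_is_submodule)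
    (use assms in \<open>auto simp: right_orbit_map_def mem_dual_carrier fun_eq_iff restrict_def extensional_def
      R.A.l_distr R.A.r_distr R.smult_mult_left R.smult_mult_right\<close>)

lemma left_orbit_map_linear:
  assumes "e \<in> dual K R"
  shows "partial_linear_map K R (functional_module K R (carrier R)) (carrier R) (left_orbit_map e)"
  by (intro partial_linear_map.intro partial_linear_map_axioms.intro R.module_axioms
      R.functional_module_module R.carrier_is_submodule)
    (use assms in \<open>auto simp: left_orbit_map_def mem_dual_carrier fun_eq_iff restrict_def extensional_def
      R.A.l_distr R.A.r_distr R.smult_mult_left R.smult_mult_right\<close>)

lemma orbit_map_inj_iff_surj:
  assumes "e \<in> dual K R"
  shows "inj_on (right_orbit_map e) (carrier R) \<longleftrightarrow> right_orbit_map e ` carrier R = dual K R"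
    and "inj_on (left_orbit_map e) (carrier R) \<longleftrightarrow> left_orbit_map e ` carrier R = dual K R"
  using dual_map_inj_iff_surj[OF R.module_axioms finitely_generated]
    right_orbit_map_linear[OF assms] left_orbit_map_linear[OF assms] by auto

lemma right_generators_iff:
  "e \<in> right_generators K R \<longleftrightarrow> e \<in> dual K R \<and> right_orbit_map e ` carrier R = dual K R"
proof -
  have "{b \<odot>\<^bsub>dual_right K R\<^esub> e | b. b \<in> carrier R} = right_orbit_map e ` carrier R"
    by (auto simp: dual_right_def right_orbit_map_def)
  then show ?thesis by (simp add: right_generators_def)
qed

lemma left_generators_iff:
  "e \<in> left_generators K R \<longleftrightarrow> e \<in> dual K R \<and> left_orbit_map e ` carrier R = dual K R"
proof -
  have "{b \<odot>\<^bsub>dual_left K R\<^esub> e | b. b \<in> carrier R} = left_orbit_map e ` carrier R"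
    by (auto simp: dual_left_def left_orbit_map_def)
  then show ?thesis by (simp add: left_generators_def)
qed

text \<open>If b e = 0, each functional e c vanishes at b, because (e c) b = e (c b) = (b e) c. When
  these are all the functionals, b = 0 since functionals separate points.\<close>

lemma left_inj_if_right_surj:
  assumes e: "e \<in> dual K R" and surj: "right_orbit_map e ` carrier R = dual K R"
  shows "inj_on (left_orbit_map e) (carrier R)"
proof -
  interpret l: partial_linear_map K R "functional_module K R (carrier R)" "carrier R" "left_orbit_map e"
    by (rule left_orbit_map_linear[OF e])
  have "b = \<zero>\<^bsub>R\<^esub>" if b: "b \<in> carrier R" "left_orbit_map e b = (\<lambda>x\<in>carrier R. \<zero>)" for b
  proof (rule dual_separates[OF R.module_axioms finitely_generated b(1)])
    fix f assume "f \<in> dual K R"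
    then obtain c where c: "c \<in> carrier R" "f = right_orbit_map e c" using surj by blast
    then have "f b = left_orbit_map e b c"
      using b(1) by (simp add: right_orbit_map_def left_orbit_map_def)
    then show "f b = \<zero>" using b(2) c(1) by simp
  qed
  then have "{x \<in> carrier R. left_orbit_map e x = \<zero>\<^bsub>functional_module K R (carrier R)\<^esub>} = {\<zero>\<^bsub>R\<^esub>}"
    using l.map_zero R.M.zero_closed unfolding functional_module_simps by blast
  then show ?thesis using l.inj_on_iff_kernel by blast
qed

lemma right_inj_if_left_surj:
  assumes e: "e \<in> dual K R" and surj: "left_orbit_map e ` carrier R = dual K R"
  shows "inj_on (right_orbit_map e) (carrier R)"
proof -
  interpret r: partial_linear_map K R "functional_module K R (carrier R)" "carrier R" "right_orbit_map e"
    by (rule right_orbit_map_linear[OF e])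
  have "b = \<zero>\<^bsub>R\<^esub>" if b: "b \<in> carrier R" "right_orbit_map e b = (\<lambda>x\<in>carrier R. \<zero>)" for b
  proof (rule dual_separates[OF R.module_axioms finitely_generated b(1)])
    fix f assume "f \<in> dual K R"
    then obtain c where c: "c \<in> carrier R" "f = left_orbit_map e c" using surj by blast
    then have "f b = right_orbit_map e b c"
      using b(1) by (simp add: right_orbit_map_def left_orbit_map_def)
    then show "f b = \<zero>" using b(2) c(1) by simp
  qed
  then have "{x \<in> carrier R. right_orbit_map e x = \<zero>\<^bsub>functional_module K R (carrier R)\<^esub>} = {\<zero>\<^bsub>R\<^esub>}"
    using r.map_zero R.M.zero_closed unfolding functional_module_simps by blast
  then show ?thesis using r.inj_on_iff_kernel by blast
qed

text \<open>A cycle of implications: surjective on one side, injective on the other by separation of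
  points, surjective there by comparison of lengths, and back again.\<close>

lemma left_generators_eq: "left_generators K R = right_generators K R"
proof (rule Set.set_eqI)
  fix e
  show "e \<in> left_generators K R \<longleftrightarrow> e \<in> right_generators K R"
  proof (cases "e \<in> dual K R")
    case True
    show ?thesis
      unfolding left_generators_iff right_generators_iff
      using left_inj_if_right_surj[OF True] right_inj_if_left_surj[OF True]
        orbit_map_inj_iff_surj[OF True] by argo
  qed (simp add: left_generators_iff right_generators_iff)
qed

lemma generator_maps:
  assumes "e \<in> right_generators K R"
  shows "e \<in> dual K R" and "bij_betw (right_orbit_map e) (carrier R) (dual K R)"
    and "bij_betw (left_orbit_map e) (carrier R) (dual K R)"
proof -
  have r: "e \<in> dual K R \<and> right_orbit_map e ` carrier R = dual K R"
    using assms by (simp only: right_generators_iff)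
  have l: "left_orbit_map e ` carrier R = dual K R"
    using assms unfolding left_generators_eq[symmetric] left_generators_iff by (rule conjunct2)
  show e: "e \<in> dual K R" using r by (rule conjunct1)
  show "bij_betw (right_orbit_map e) (carrier R) (dual K R)"
    "bij_betw (left_orbit_map e) (carrier R) (dual K R)"
    using r l orbit_map_inj_iff_surj[OF e] unfolding bij_betw_def by simp_all
qed

section \<open>Forms and isomorphisms determined by a functional\<close>

lemma right_orbit_map_one: "e \<in> dual K R \<Longrightarrow> right_orbit_map e \<one>\<^bsub>R\<^esub> = e"
  by (auto simp: right_orbit_map_def mem_dual_carrier fun_eq_iff restrict_def extensional_def)

lemma left_orbit_map_one: "e \<in> dual K R \<Longrightarrow> left_orbit_map e \<one>\<^bsub>R\<^esub> = e"
  by (auto simp: left_orbit_map_def mem_dual_carrier fun_eq_iff restrict_def extensional_def)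

lemma slot_right_orbit_map: "slot_right R (right_orbit_map e) = right_orbit_map e"
  by (auto simp: slot_right_def right_orbit_map_def fun_eq_iff restrict_def)

lemma slot_left_orbit_map: "slot_left R (right_orbit_map e) = left_orbit_map e"
  by (auto simp: slot_left_def right_orbit_map_def left_orbit_map_def fun_eq_iff restrict_def)

lemma orbit_map_mem_dual:
  assumes "e \<in> dual K R" "b \<in> carrier R"
  shows "right_orbit_map e b \<in> dual K R" "left_orbit_map e b \<in> dual K R"
  using partial_linear_map.map_closed[OF right_orbit_map_linear[OF assms(1)] assms(2)]
    partial_linear_map.map_closed[OF left_orbit_map_linear[OF assms(1)] assms(2)] by simp_all

lemma orbit_map_frobenius_form:
  assumes e: "e \<in> right_generators K R"
  shows "right_orbit_map e \<in> frobenius_forms K R"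
proof -
  note g = generator_maps[OF e]
  have "e x \<in> carrier K" if "x \<in> carrier R" for x using g(1) that by (simp add: mem_dual_carrier)
  then have "right_orbit_map e \<in> carrier R \<rightarrow>\<^sub>E carrier R \<rightarrow>\<^sub>E carrier K"
    by (auto simp: right_orbit_map_def)
  then have "right_orbit_map e \<in> bilinear_forms K R"
    unfolding bilinear_forms_def slot_right_orbit_map slot_left_orbit_map
    using orbit_map_mem_dual[OF g(1)]
    by (auto simp: slot_right_orbit_map slot_left_orbit_map)
  moreover have "associative_form R (right_orbit_map e)"
    by (simp add: associative_form_def right_orbit_map_def R.A.m_assoc)
  moreover have "nondegenerate_form R (right_orbit_map e)"
    unfolding nondegenerate_form_def slot_right_orbit_map slot_left_orbit_map
    using g(2,3) by (simp add: bij_betw_def)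
  ultimately show ?thesis by (simp add: frobenius_forms_def)
qed

text \<open>Associativity gives B x y = B 1 (x y), so the form is the orbit map of e = B 1.
  Injectivity of the right slot is that of b -> e b, and equality of lengths turns it into e R being
  the whole dual.\<close>

lemma frobenius_form_eq:
  assumes B: "B \<in> frobenius_forms K R"
  shows "B \<one>\<^bsub>R\<^esub> \<in> right_generators K R" and "right_orbit_map (B \<one>\<^bsub>R\<^esub>) = B"
proof -
  have car: "B \<in> carrier R \<rightarrow>\<^sub>E carrier R \<rightarrow>\<^sub>E carrier K"
    and dual: "\<And>b. b \<in> carrier R \<Longrightarrow> slot_right R B b \<in> dual K R"
    and assoc: "associative_form R B" and nd: "inj_on (slot_right R B) (carrier R)"
    using B by (auto simp: frobenius_forms_def bilinear_forms_def nondegenerate_form_def)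
  have slot: "slot_right R B = B"
    using car by (auto simp: slot_right_def PiE_iff extensional_def restrict_def fun_eq_iff)
  show eq: "right_orbit_map (B \<one>\<^bsub>R\<^esub>) = B"
  proof (intro ext)
    fix x y
    show "right_orbit_map (B \<one>\<^bsub>R\<^esub>) x y = B x y"
    proof (cases "x \<in> carrier R \<and> y \<in> carrier R")
      case True
      then have "B (\<one>\<^bsub>R\<^esub> \<otimes>\<^bsub>R\<^esub> x) y = B \<one>\<^bsub>R\<^esub> (x \<otimes>\<^bsub>R\<^esub> y)"
        using assoc by (simp only: associative_form_def R.A.one_closed)
      then show ?thesis using True by (simp add: right_orbit_map_def)
    next
      \<comment> \<open>Outside the carrier both sides have the default values prescribed by
        extensionality.\<close>
      case False
      then show ?thesis
        using car by (auto simp: right_orbit_map_def PiE_iff extensional_def restrict_def)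
    qed
  qed
  have "B \<one>\<^bsub>R\<^esub> \<in> dual K R" using dual[of "\<one>\<^bsub>R\<^esub>"] slot by simp
  moreover have "inj_on (right_orbit_map (B \<one>\<^bsub>R\<^esub>)) (carrier R)" using nd slot eq by simp
  ultimately show "B \<one>\<^bsub>R\<^esub> \<in> right_generators K R"
    using orbit_map_inj_iff_surj(1) right_generators_iff by blast
qed

lemma bij_forms_generators:
  "bij_betw (\<lambda>B. B \<one>\<^bsub>R\<^esub>) (frobenius_forms K R) (right_generators K R)"
  by (rule bij_betwI[where g = right_orbit_map])
    (auto simp: frobenius_form_eq orbit_map_frobenius_form right_orbit_map_one generator_maps(1))

text \<open>A homomorphism out of the regular module is determined at 1, by \<alpha> b = \<alpha> (1
  b) = (\<alpha> 1) b; surjectivity of \<alpha> makes \<alpha> 1 a generator.\<close>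

lemma right_iso_eq:
  assumes "\<alpha> \<in> right_isos K R"
  shows "\<alpha> \<one>\<^bsub>R\<^esub> \<in> right_generators K R" and "right_orbit_map (\<alpha> \<one>\<^bsub>R\<^esub>) = \<alpha>"
proof -
  have a: "\<alpha> \<in> extensional (carrier R)" "\<And>x. x \<in> carrier R \<Longrightarrow> \<alpha> x \<in> dual K R"
    "bij_betw \<alpha> (carrier R) (dual K R)"
    and act: "\<And>b x. b \<in> carrier R \<Longrightarrow> x \<in> carrier R \<Longrightarrow>
      \<alpha> (x \<otimes>\<^bsub>R\<^esub> b) = (\<lambda>y\<in>carrier R. \<alpha> x (b \<otimes>\<^bsub>R\<^esub> y))"
    using assms
    by (auto simp: right_isos_def module_isos_def module_homs_def right_regular_def dual_right_def PiE_iff)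
  have "right_orbit_map (\<alpha> \<one>\<^bsub>R\<^esub>) b = \<alpha> b" for b
    using act[of b "\<one>\<^bsub>R\<^esub>"] a(1) by (auto simp: right_orbit_map_def extensional_def)
  then show eq: "right_orbit_map (\<alpha> \<one>\<^bsub>R\<^esub>) = \<alpha>" by (rule ext)
  show "\<alpha> \<one>\<^bsub>R\<^esub> \<in> right_generators K R"
    using a(2)[of "\<one>\<^bsub>R\<^esub>"] a(3) eq by (simp add: right_generators_iff bij_betw_def)
qed

lemma left_iso_eq:
  assumes "\<beta> \<in> left_isos K R"
  shows "\<beta> \<one>\<^bsub>R\<^esub> \<in> left_generators K R" and "left_orbit_map (\<beta> \<one>\<^bsub>R\<^esub>) = \<beta>"
proof -
  have b: "\<beta> \<in> extensional (carrier R)" "\<And>x. x \<in> carrier R \<Longrightarrow> \<beta> x \<in> dual K R"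
    "bij_betw \<beta> (carrier R) (dual K R)"
    and act: "\<And>b x. b \<in> carrier R \<Longrightarrow> x \<in> carrier R \<Longrightarrow>
      \<beta> (b \<otimes>\<^bsub>R\<^esub> x) = (\<lambda>y\<in>carrier R. \<beta> x (y \<otimes>\<^bsub>R\<^esub> b))"
    using assms
    by (auto simp: left_isos_def module_isos_def module_homs_def dual_left_def PiE_iff)
  have "left_orbit_map (\<beta> \<one>\<^bsub>R\<^esub>) b = \<beta> b" for b
    using act[of b "\<one>\<^bsub>R\<^esub>"] b(1) by (auto simp: left_orbit_map_def extensional_def)
  then show eq: "left_orbit_map (\<beta> \<one>\<^bsub>R\<^esub>) = \<beta>" by (rule ext)
  show "\<beta> \<one>\<^bsub>R\<^esub> \<in> left_generators K R"
    using b(2)[of "\<one>\<^bsub>R\<^esub>"] b(3) eq by (simp add: left_generators_iff bij_betw_def)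
qed

lemma right_orbit_map_iso:
  assumes e: "e \<in> right_generators K R"
  shows "right_orbit_map e \<in> right_isos K R"
proof -
  note g = generator_maps[OF e]
  show ?thesis
    unfolding right_isos_def module_isos_def module_homs_def
    using g(2) orbit_map_mem_dual(1)[OF g(1)] g(1)
    by (auto simp: right_regular_def dual_right_def PiE_iff)
      (auto simp: right_orbit_map_def mem_dual_carrier fun_eq_iff restrict_def extensional_def
        R.A.l_distr R.A.r_distr R.A.m_assoc)
qed

text \<open>Right generators are assumed although the map belongs to the left side, so that one set
  of functionals parametrises all the structures.\<close>

lemma left_orbit_map_iso:
  assumes e: "e \<in> right_generators K R"
  shows "left_orbit_map e \<in> left_isos K R"
proof -
  note g = generator_maps[OF e]
  show ?thesis
    unfolding left_isos_def module_isos_def module_homs_def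
    using g(3) orbit_map_mem_dual(2)[OF g(1)] g(1)
    by (auto simp: dual_left_def PiE_iff)
      (auto simp: left_orbit_map_def mem_dual_carrier fun_eq_iff restrict_def extensional_def
        R.A.l_distr R.A.r_distr R.A.m_assoc)
qed

lemma frobenius_form_slots:
  assumes "B \<in> frobenius_forms K R"
  shows "slot_right R B = right_orbit_map (B \<one>\<^bsub>R\<^esub>)" and "slot_left R B = left_orbit_map (B \<one>\<^bsub>R\<^esub>)"
  using slot_right_orbit_map[of "B \<one>\<^bsub>R\<^esub>"] slot_left_orbit_map[of "B \<one>\<^bsub>R\<^esub>"] frobenius_form_eq(2)[OF assms]
  by simp_all

text \<open>Every map factors through B -> B 1, a bijection from forms to generators, and the orbit
  maps turn a generator into an isomorphism. Associativity gives B 1 x = B x 1, so the last two maps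
  select the same functional.\<close>

lemma correspondences:
  "bij_betw (\<lambda>B. slot_right R B) (frobenius_forms K R) (right_isos K R)"
  "bij_betw (\<lambda>B. slot_left R B) (frobenius_forms K R) (left_isos K R)"
  "bij_betw (\<lambda>B. slot_right R B \<one>\<^bsub>R\<^esub>) (frobenius_forms K R) (right_generators K R)"
  "bij_betw (\<lambda>B. slot_left R B \<one>\<^bsub>R\<^esub>) (frobenius_forms K R) (left_generators K R)"
proof -
  have right: "bij_betw right_orbit_map (right_generators K R) (right_isos K R)"
    by (rule bij_betwI[where g = "\<lambda>\<alpha>. \<alpha> \<one>\<^bsub>R\<^esub>"])
      (auto simp: right_iso_eq right_orbit_map_iso right_orbit_map_one generator_maps(1))
  have left: "bij_betw left_orbit_map (right_generators K R) (left_isos K R)"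
    by (rule bij_betwI[where g = "\<lambda>\<beta>. \<beta> \<one>\<^bsub>R\<^esub>"])
      (auto simp: left_iso_eq left_orbit_map_iso left_orbit_map_one generator_maps(1)
        simp flip: left_generators_eq)
  have d: "B \<one>\<^bsub>R\<^esub> \<in> dual K R" if "B \<in> frobenius_forms K R" for B
    using frobenius_form_eq(1)[OF that] generator_maps(1) by blast
  show "bij_betw (\<lambda>B. slot_right R B) (frobenius_forms K R) (right_isos K R)"
    using bij_betw_trans[OF bij_forms_generators right]
    by (rule bij_betw_cong[THEN iffD1, rotated]) (simp add: frobenius_form_slots)
  show "bij_betw (\<lambda>B. slot_left R B) (frobenius_forms K R) (left_isos K R)"
    using bij_betw_trans[OF bij_forms_generators left]
    by (rule bij_betw_cong[THEN iffD1, rotated]) (simp add: frobenius_form_slots)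
  show "bij_betw (\<lambda>B. slot_right R B \<one>\<^bsub>R\<^esub>) (frobenius_forms K R) (right_generators K R)"
    using bij_forms_generators
    by (rule bij_betw_cong[THEN iffD1, rotated]) (simp add: frobenius_form_slots d right_orbit_map_one)
  show "bij_betw (\<lambda>B. slot_left R B \<one>\<^bsub>R\<^esub>) (frobenius_forms K R) (left_generators K R)"
    unfolding left_generators_eq using bij_forms_generators
    by (rule bij_betw_cong[THEN iffD1, rotated]) (simp add: frobenius_form_slots d left_orbit_map_one)
qed

end

text \<open>The forms are the hub: composing one of these bijections with the inverse of another
  relates any two of the five structures. Explicit maps are given, since the bare existence of
  bijections would say less.\<close>

theorem proposition9:
  fixes K :: "('k, 'm) ring_scheme" and R :: "('k, 'r, 'n) module_scheme"
  assumes "cring K" and "frobenius_ring K"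
    and "ring_algebra K R" and "finitely_generated_module K R"
  shows "bij_betw (\<lambda>B. slot_right R B) (frobenius_forms K R) (right_isos K R)
      \<and> bij_betw (\<lambda>B. slot_left R B) (frobenius_forms K R) (left_isos K R)
      \<and> bij_betw (\<lambda>B. slot_right R B \<one>\<^bsub>R\<^esub>) (frobenius_forms K R) (right_generators K R)
      \<and> bij_betw (\<lambda>B. slot_left R B \<one>\<^bsub>R\<^esub>) (frobenius_forms K R) (left_generators K R)"
proof -
  interpret finite_frobenius_algebra K R
    by (intro finite_frobenius_algebra.intro commutative_frobenius.intro
        commutative_frobenius_axioms.intro finite_frobenius_algebra_axioms.intro assms)
  show ?thesis using correspondences by blast
qed

end
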